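(* Let $N, r\in\mathbb{N}$, let $\varphi\in C^0(\mathbb{R}^N)$ and $\psi\in L^1(\mathbb{R}^N)$ be real-valued, and let $\mathbf{p}=(p_1,\dots,p_N):\mathbb{N}\to\mathbb{R}^N$ satisfy $p_i(n)>0$ for all $i$ and $n$, $\lim_{n\to\infty}p_i(n)=+\infty$ and $\lim_{n\to\infty} n/p_i(n)=a_i>0$ for every $i=1,\dots,N$. Assume: (i) for every $\mathbf{u}\in\mathbb{R}^N$, $\sum_{\mathbf{k}\in\mathbb{Z}^N}\varphi(\mathbf{u}-\mathbf{k})=1$, and $\int_{\mathbb{R}^N}\psi(\mathbf{t})\,d\mathbf{t}=1$; (ii) for every $\nu=1,\dots,r$ and every $\mathbf{h}\in\mathbb{N}_0^N$ with $|\mathbf{h}|=\nu$, the moment $m^\nu_{\mathbf{h}}(\varphi,\mathbf{u})$ is a real number independent of $\mathbf{u}\in\mathbb{R}^N$, denoted $m^\nu_{\mathbf{h}}(\varphi)$; (iii) $M_r(\varphi)+\widetilde{M}_r(\psi)<+\infty$ and $\lim_{w\to+\infty}\sum_{\|\mathbf{u}-\mathbf{k}\|>w}|\varphi(\mathbf{u}-\mathbf{k})|\,\|\mathbf{u}-\mathbf{k}\|^r=0$ uniformly with respect to $\mathbf{u}\in\mathbb{R}^N$. Let $f\in L^\infty(\mathbb{R}^N)$, let $\mathbf{x}\in\mathbb{R}^N$ be fixed, and assume that $f$ belongs to $C^r$ locally at $\mathbf{x}$. Then, as $n\to+\infty$, $$(S^{\varphi,\psi}_{\mathbf{p}(n)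}f)(\mathbf{x})-f(\mathbf{x})=\sum_{\nu=1}^r\sum_{|\mathbf{h}|=\nu}\frac{D^{\mathbf{h}}f(\mathbf{x})}{\mathbf{h}!\,(\mathbf{p}(n))^{\mathbf{h}}}\sum_{\mathbf{s}=\mathbf{0}}^{\mathbf{h}}\binom{\mathbf{h}}{\mathbf{s}}m^{|\mathbf{h}-\mathbf{s}|}_{\mathbf{h}-\mathbf{s}}(\varphi)\,\widetilde{m}^{|\mathbf{s}|}_{\mathbf{s}}(\psi)+o(\|\mathbf{p}(n)\|^{-r}).$$
   Context: Notation. $\mathbb{N}$ is the set of positive integers, $\mathbb{N}_0$ the non-negative integers. $\|\cdot\|$ is the Euclidean norm on $\mathbb{R}^N$. For $\mathbf{x},\mathbf{y}\in\mathbb{R}^N$: $\mathbf{x}\mathbf{y}=(x_1y_1,\dots,x_Ny_N)$ (componentwise product), $\langle\mathbf{x}\rangle=\prod_{i=1}^N x_i$, $[\mathbf{x}]=(|x_1|,\dots,|x_N|)$, and $\mathbf{x}^{\mathbf{h}}=\prod_i x_i^{h_i}$ for $\mathbf{h}\in\mathbb{N}_0^N$. Multi-indices: $|\mathbf{h}|=h_1+\dots+h_N$, $\mathbf{h}!=\prod_i h_i!$, $\binom{\mathbf{h}}{\mathbf{s}}=\prod_i\binom{h_i}{s_i}$, $D^{\mathbf{h}}f=\partial^{|\mathbf{h}|}f/\partial x_1^{h_1}\cdots\partial x_N^{h_N}$; sums $\sum_{|\mathbf{h}|=\nu}$ run over $\mathbf{h}\in\mathbb{N}_0^N$, and $\sum_{\mathbf{s}=\mathbf{0}}^{\mathbf{h}}$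 runs over $\mathbf{s}\in\mathbb{N}_0^N$ with $s_i\le h_i$ for all $i$. Function spaces. $C^0=C^0(\mathbb{R}^N)$ is the space of bounded uniformly continuous functions $\mathbb{R}^N\to\mathbb{R}$. A function $f$ belongs to $C^r$ locally at $\mathbf{x}$ if there is a neighbourhood $U$ of $\mathbf{x}$ such that $f$ is $(r-1)$-fold continuously differentiable in $U$ and the $r$-th order derivatives exist and are continuous at $\mathbf{x}$. Moments. For $\nu\in\mathbb{N}_0$, $\mathbf{h}\in\mathbb{N}_0^N$ with $|\mathbf{h}|=\nu$: $m^\nu_{\mathbf{h}}(\varphi,\mathbf{u})=\sum_{\mathbf{k}\in\mathbb{Z}^N}\varphi(\mathbf{u}-\mathbf{k})(\mathbf{k}-\mathbf{u})^{\mathbf{h}}$, $\widetilde{m}^\nu_{\mathbf{h}}(\psi)=\int_{\mathbb{R}^N}\mathbf{t}^{\mathbf{h}}\psi(\mathbf{t})\,d\mathbf{t}$, $M^\nu_{\mathbf{h}}(\varphi)=\sup_{\mathbf{u}\in\mathbb{R}^N}\sum_{\mathbf{k}\in\mathbb{Z}^N}|\varphi(\mathbf{u}-\mathbf{k})|[\mathbf{u}-\mathbf{k}]^{\mathbf{h}}$, $\widetilde{M}^\nu_{\mathbf{h}}(\psi)=\int_{\mathbb{R}^N}[\mathbf{t}]^{\mathbf{h}}|\psi(\mathbf{t})|\,d\mathbf{t}$, $M_\nu(\varphi)=\max_{|\mathbf{h}|=\nu}M^\nu_{\mathbf{h}}(\varphi)$, $\widetilde{M}_\nu(\psi)=\max_{|\mathbf{h}|=\nu}\widetilde{M}^\nu_{\mathbf{h}}(\psi)$.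 When $m^\nu_{\mathbf{h}}(\varphi,\mathbf{u})$ does not depend on $\mathbf{u}$ it is written $m^\nu_{\mathbf{h}}(\varphi)$; in particular $m^0_{\mathbf{0}}(\varphi)=1$ under (i). Operator. The multivariate generalized Durrmeyer sampling type series is $$(S^{\varphi,\psi}_{\mathbf{p}(n)}f)(\mathbf{x})=\sum_{\mathbf{k}\in\mathbb{Z}^N}\varphi(\mathbf{p}(n)\mathbf{x}-\mathbf{k})\Big[\langle\mathbf{p}(n)\rangle\int_{\mathbb{R}^N}\psi(\mathbf{p}(n)\mathbf{u}-\mathbf{k})f(\mathbf{u})\,d\mathbf{u}\Big],\quad \mathbf{x}\in\mathbb{R}^N.$$ *)

theory Defs
  imports "HOL-Analysis.Analysis" "HOL-Library.Landau_Symbols"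
begin

text \<open>The dimension $N$ is the cardinality of the finite index type \<open>'n\<close>; multi-indices have type
  \<open>nat ^ 'n\<close> (with the library's componentwise order and subtraction), and $\mathbb{Z}^N$ is the
  whole type \<open>int ^ 'n\<close>, embedded into \<open>real ^ 'n\<close> by \<open>lattice_pt\<close>. On \<open>real ^ 'n\<close>, the library's
  product \<open>x * y\<close> and absolute value \<open>\<bar>x\<bar>\<close> are componentwise.\<close>

definition lattice_pt :: "int ^ 'n \<Rightarrow> real ^ 'n" where
  "lattice_pt k = (\<chi> i. real_of_int (k $ i))"

definition vprod :: "real ^ 'n \<Rightarrow> real" where
  "vprod x = (\<Prod>i\<in>UNIV. x $ i)"

definition vpow :: "real ^ 'n \<Rightarrow> nat ^ 'n \<Rightarrow> real" where
  "vpow x h = (\<Prod>i\<in>UNIV. x $ i ^ (h $ i))"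

definition mi_order :: "nat ^ 'n \<Rightarrow> nat" where
  "mi_order h = (\<Sum>i\<in>UNIV. h $ i)"

definition mi_fact :: "nat ^ 'n \<Rightarrow> nat" where
  "mi_fact h = (\<Prod>i\<in>UNIV. fact (h $ i))"

definition mi_binom :: "nat ^ 'n \<Rightarrow> nat ^ 'n \<Rightarrow> nat" where
  "mi_binom h s = (\<Prod>i\<in>UNIV. (h $ i) choose (s $ i))"

definition has_partial :: "'n \<Rightarrow> (real ^ 'n \<Rightarrow> real) \<Rightarrow> real ^ 'n \<Rightarrow> bool" where
  "has_partial i g x \<longleftrightarrow> (\<lambda>t. g (x + t *\<^sub>R axis i 1)) field_differentiable (at 0)"

definition partial :: "'n \<Rightarrow> (real ^ 'n \<Rightarrow> real) \<Rightarrow> real ^ 'n \<Rightarrow> real" where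
  "partial i g x = deriv (\<lambda>t. g (x + t *\<^sub>R axis i 1)) 0"

text \<open>\<open>iter_partial [i\<^sub>1, \<dots>, i\<^sub>m] f\<close> is
  $\partial_{i_1} (\partial_{i_2} (\cdots (\partial_{i_m} f)))$.\<close>

definition iter_partial :: "'n list \<Rightarrow> (real ^ 'n \<Rightarrow> real) \<Rightarrow> real ^ 'n \<Rightarrow> real" where
  "iter_partial js f = foldr partial js f"

text \<open>The index type carries no order, so an enumeration of the coordinates is fixed once and for
  all. It only determines the order of differentiation in \<open>mixed_partial\<close>, which is immaterial
  for the derivatives of order at most \<open>r\<close>, at \<open>x\<close>, of a function that is \<open>C\<^sup>r\<close> locally at \<open>x\<close>.\<close>

definition coords :: "'n::finite list" where
  "coords = (SOME js. distinct js \<and> set js = UNIV)"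

definition mixed_partial :: "nat ^ 'n \<Rightarrow> (real ^ 'n \<Rightarrow> real) \<Rightarrow> real ^ 'n \<Rightarrow> real" where
  "mixed_partial h f = iter_partial (concat (map (\<lambda>i. replicate (h $ i) i) coords)) f"

definition C0_space :: "(real ^ 'n \<Rightarrow> real) set" where
  "C0_space = {g. bounded (range g) \<and> uniformly_continuous_on UNIV g}"

definition Linf_space :: "(real ^ 'n \<Rightarrow> real) set" where
  "Linf_space = {g. g \<in> borel_measurable lebesgue \<and> (\<exists>C. AE u in lebesgue. \<bar>g u\<bar> \<le> C)}"

text \<open>Meant for \<open>r \<ge> 1\<close>. Derivatives are taken along arbitrary sequences of coordinates. Those of
  order up to \<open>r - 1\<close> exist and are continuous on the neighbourhood \<open>U\<close>; those of order \<open>r\<close> exist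
  on \<open>U\<close> (so that continuity at a point makes sense) and are continuous at \<open>x\<close>.\<close>

definition C_locally_at :: "nat \<Rightarrow> (real ^ 'n \<Rightarrow> real) \<Rightarrow> real ^ 'n \<Rightarrow> bool" where
  "C_locally_at r f x \<longleftrightarrow>
    (\<exists>U. open U \<and> x \<in> U \<and>
      (\<forall>js. length js < r \<longrightarrow> continuous_on U (iter_partial js f)) \<and>
      (\<forall>js i. length js < r \<longrightarrow> (\<forall>y\<in>U. has_partial i (iter_partial js f) y)) \<and>
      (\<forall>js. length js = r \<longrightarrow> isCont (iter_partial js f) x))"

text \<open>The order $\nu = |\mathbf{h}|$ is determined by \<open>h\<close> and is not a separate argument.\<close>

definition discrete_moment_term ::
    "(real ^ 'n \<Rightarrow> real) \<Rightarrow> nat ^ 'n \<Rightarrow> real ^ 'n \<Rightarrow> int ^ 'n \<Rightarrow> real" where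
  "discrete_moment_term \<phi> h u k = \<phi> (u - lattice_pt k) * vpow (lattice_pt k - u) h"

definition discrete_moment_at ::
    "(real ^ 'n \<Rightarrow> real) \<Rightarrow> nat ^ 'n \<Rightarrow> real ^ 'n \<Rightarrow> real" where
  "discrete_moment_at \<phi> h u = (\<Sum>\<^sub>\<infinity>k. discrete_moment_term \<phi> h u k)"

text \<open>The common value of \<open>discrete_moment_at \<phi> h u\<close> when it does not depend on \<open>u\<close>.\<close>

definition discrete_moment :: "(real ^ 'n \<Rightarrow> real) \<Rightarrow> nat ^ 'n \<Rightarrow> real" where
  "discrete_moment \<phi> h = (THE c. \<forall>u. discrete_moment_at \<phi> h u = c)"

definition cont_moment :: "(real ^ 'n \<Rightarrow> real) \<Rightarrow> nat ^ 'n \<Rightarrow> real" where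
  "cont_moment \<psi> h = (LINT t|lebesgue. vpow t h * \<psi> t)"

text \<open>Absolute moments may be infinite and therefore take values in \<open>ennreal\<close>.\<close>

definition abs_discrete_moment :: "(real ^ 'n \<Rightarrow> real) \<Rightarrow> nat ^ 'n \<Rightarrow> ennreal" where
  "abs_discrete_moment \<phi> h =
    (SUP u. \<Sum>\<^sub>\<infinity>k. ennreal (\<bar>\<phi> (u - lattice_pt k)\<bar> * vpow \<bar>u - lattice_pt k\<bar> h))"

definition abs_cont_moment :: "(real ^ 'n \<Rightarrow> real) \<Rightarrow> nat ^ 'n \<Rightarrow> ennreal" where
  "abs_cont_moment \<psi> h = (\<integral>\<^sup>+ t. ennreal (vpow \<bar>t\<bar> h * \<bar>\<psi> t\<bar>) \<partial>lebesgue)"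

definition max_abs_discrete_moment :: "nat \<Rightarrow> (real ^ 'n \<Rightarrow> real) \<Rightarrow> ennreal" where
  "max_abs_discrete_moment \<nu> \<phi> = Max (abs_discrete_moment \<phi> ` {h. mi_order h = \<nu>})"

definition max_abs_cont_moment :: "nat \<Rightarrow> (real ^ 'n \<Rightarrow> real) \<Rightarrow> ennreal" where
  "max_abs_cont_moment \<nu> \<psi> = Max (abs_cont_moment \<psi> ` {h. mi_order h = \<nu>})"

text \<open>The argument \<open>q\<close> is the value of the scaling sequence, $\mathbf{q} = \mathbf{p}(n)$.\<close>

definition durrmeyer ::
    "(real ^ 'n \<Rightarrow> real) \<Rightarrow> (real ^ 'n \<Rightarrow> real) \<Rightarrow> real ^ 'n \<Rightarrow> (real ^ 'n \<Rightarrow> real) \<Rightarrow> real ^ 'n \<Rightarrow> real"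
  where
  "durrmeyer \<phi> \<psi> q f x =
    (\<Sum>\<^sub>\<infinity>k. \<phi> (q * x - lattice_pt k) *
      (vprod q * (LINT u|lebesgue. \<psi> (q * u - lattice_pt k) * f u)))"

end

theory Submission
  imports Defs
begin

text \<open>Write $\mathbf q = \mathbf p(n)$. After the substitution $\mathbf t = \mathbf q\mathbf u - \mathbf k$ the
  integral belonging to $\mathbf k$ is $\int \psi(\mathbf t) f(\mathbf x + (\mathbf t - \mathbf v)/\mathbf q)\,d\mathbf t$
  with $\mathbf v = \mathbf q\mathbf x - \mathbf k$. On the Taylor polynomial of \<open>f\<close> at \<open>x\<close> the operator is
  evaluated exactly by the binomial formula, which gives the moments. The Taylor remainder \<open>E\<close>
  satisfies $|E(\mathbf y)| \le K\|\mathbf y\|^r$ everywhere, because \<open>f\<close> may be taken bounded, and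
  $|E(\mathbf y)| \le \varepsilon\|\mathbf y\|^r$ for $\|\mathbf y\| \le \delta$. As all $q_i$ are of the order
  of $\|\mathbf q\|$, the second bound applies unless $\|\mathbf v\|$ or $\|\mathbf t\|$ exceeds a multiple of
  $\|\mathbf q\|$, and those contributions are tails: of the discrete kernel, which vanish uniformly by
  (iii), and of the integral of $\|\mathbf t\|^r|\psi(\mathbf t)|$. The tail condition together with the
  boundedness of \<open>\<phi>\<close> also bounds the sums $\sum_{\mathbf k}|\varphi(\mathbf v)|(1 + \|\mathbf v\|^r)$
  uniformly.\<close>

subsection \<open>Multi-indices\<close>

lemma finite_vec_box:
  fixes B :: "'n::finite \<Rightarrow> 'a set"
  assumes "\<And>i. finite (B i)"
  shows "finite {h :: 'a ^ 'n. \<forall>i. h $ i \<in> B i}"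
proof (rule finite_subset)
  show "{h :: 'a ^ 'n. \<forall>i. h $ i \<in> B i} \<subseteq> vec_lambda ` (PiE UNIV B)"
  proof
    fix h :: "'a ^ 'n" assume "h \<in> {h. \<forall>i. h $ i \<in> B i}"
    then have "($) h \<in> PiE UNIV B" by auto
    then show "h \<in> vec_lambda ` (PiE UNIV B)"
      by (metis image_eqI vec_nth_inverse)
  qed
  show "finite (vec_lambda ` (PiE UNIV B))"
    using assms by (intro finite_imageI finite_PiE) auto
qed

lemma finite_multi_index_le: "finite {s :: nat ^ 'n. s \<le> h}"
  using finite_vec_box[of "\<lambda>i. {..h $ i}"] by (simp add: less_eq_vec_def)

lemma component_le_mi_order: "h $ i \<le> mi_order h"
  unfolding mi_order_def by (rule member_le_sum) auto

lemma finite_mi_order_le: "finite {h :: nat ^ 'n. mi_order h \<le> m}"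
  by (rule finite_subset[OF _ finite_vec_box[of "\<lambda>i. {..m}"]])
    (auto intro: order_trans[OF component_le_mi_order])

lemma finite_mi_order_eq: "finite {h :: nat ^ 'n. mi_order h = m}"
  by (rule finite_subset[OF _ finite_mi_order_le[of m]]) auto

lemma mi_order_0 [simp]: "mi_order 0 = 0"
  by (simp add: mi_order_def)

lemma mi_order_eq_0_iff: "mi_order h = 0 \<longleftrightarrow> h = 0"
  by (simp add: mi_order_def vec_eq_iff)

lemma mi_order_add: "mi_order (h + k) = mi_order h + mi_order k"
  by (simp add: mi_order_def sum.distrib)

lemma mi_order_axis [simp]: "mi_order (axis i j) = j"
  by (simp add: mi_order_def axis_def)

lemma mi_fact_0 [simp]: "mi_fact 0 = 1"
  by (simp add: mi_fact_def)

lemma vpow_0 [simp]: "vpow x 0 = 1"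
  by (simp add: vpow_def)

lemma vpow_axis: "vpow x (axis i j) = x $ i ^ j"
proof -
  have "vpow x (axis i j) = (\<Prod>l\<in>UNIV. if l = i then x $ i ^ j else 1)"
    unfolding vpow_def by (rule prod.cong) (auto simp: axis_def)
  then show ?thesis by simp
qed

lemma vpow_add: "vpow x (h + k) = vpow x h * vpow x k"
  by (simp add: vpow_def power_add prod.distrib)

lemma abs_vpow_le_norm_power: "\<bar>vpow x h\<bar> \<le> norm x ^ mi_order h"
proof -
  have "\<bar>vpow x h\<bar> = (\<Prod>i\<in>UNIV. \<bar>x $ i\<bar> ^ (h $ i))"
    by (simp add: vpow_def abs_prod power_abs)
  also have "\<dots> \<le> (\<Prod>i\<in>UNIV. norm x ^ (h $ i))"
    by (intro prod_mono) (auto intro: power_mono component_le_norm_cart)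
  finally show ?thesis by (simp add: mi_order_def power_sum)
qed

lemma mi_fact_add_axis:
  assumes "h $ c = 0"
  shows "mi_fact (h + axis c j) = mi_fact h * fact j"
proof -
  have "mi_fact (h + axis c j) = (\<Prod>i\<in>UNIV. fact (h $ i) * (if i = c then fact j else 1))"
    unfolding mi_fact_def by (rule prod.cong) (auto simp: axis_def assms)
  then show ?thesis by (simp add: mi_fact_def prod.distrib)
qed

text \<open>The binomial formulas of the single coordinates are multiplied out; choosing one term
  from each factor amounts to choosing the multi-index \<open>s\<close>.\<close>

lemma vpow_add_binomial:
  "vpow (x + y) h = (\<Sum>s\<in>{s. s \<le> h}. real (mi_binom h s) * vpow x (h - s) * vpow y s)"
proof -
  have "vpow (x + y) h = (\<Prod>i\<in>UNIV. \<Sum>j\<le>h $ i. real (h $ i choose j) * x $ i ^ (h $ i - j) * y $ i ^ j)"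
    unfolding vpow_def
  proof (rule prod.cong)
    fix i
    have "(x + y) $ i ^ (h $ i) = (y $ i + x $ i) ^ (h $ i)" by (simp add: add.commute)
    also have "\<dots> = (\<Sum>j\<le>h $ i. real (h $ i choose j) * x $ i ^ (h $ i - j) * y $ i ^ j)"
      by (subst binomial_ring) (simp add: algebra_simps)
    finally show "(x + y) $ i ^ (h $ i) = \<dots>" .
  qed simp
  also have "\<dots> = (\<Sum>g\<in>PiE UNIV (\<lambda>i. {..h $ i}). \<Prod>i\<in>UNIV.
      real (h $ i choose g i) * x $ i ^ (h $ i - g i) * y $ i ^ g i)"
    by (rule prod_sum_PiE) auto
  also have "\<dots> = (\<Sum>s\<in>{s. s \<le> h}. \<Prod>i\<in>UNIV.
      real (h $ i choose s $ i) * x $ i ^ (h $ i - s $ i) * y $ i ^ (s $ i))"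
    by (rule sum.reindex_bij_witness[of _ "($)" vec_lambda])
      (auto simp: less_eq_vec_def PiE_UNIV_domain vec_nth_inverse)
  finally show ?thesis
    by (simp add: vpow_def mi_binom_def prod.distrib)
qed

subsection \<open>Taylor's formula\<close>

text \<open>Expanding one coordinate after the other, in the order fixed by \<open>coords\<close>, produces
  exactly the derivatives \<open>mixed_partial\<close>; hence the symmetry of mixed derivatives is not needed.\<close>

lemma iter_partial_Nil [simp]: "iter_partial [] g = g"
  by (simp add: iter_partial_def)

lemma iter_partial_append: "iter_partial (js @ ks) g = iter_partial js (iter_partial ks g)"
  by (simp add: iter_partial_def)

text \<open>\<open>partial\<close> differentiates at parameter 0 of the line through the point
  itself. Shifting the parameter gives the derivative at \<open>t\<close> along one fixed line,
  which is what the one-dimensional Taylor formula works with.\<close>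

lemma has_partial_imp_DERIV:
  assumes "has_partial c g (x + t *\<^sub>R axis c 1)"
  shows "((\<lambda>s. g (x + s *\<^sub>R axis c 1)) has_field_derivative partial c g (x + t *\<^sub>R axis c 1)) (at t)"
proof -
  have "((\<lambda>s. g (x + t *\<^sub>R axis c 1 + s *\<^sub>R axis c 1)) has_field_derivative
      partial c g (x + t *\<^sub>R axis c 1)) (at 0)"
    using assms unfolding has_partial_def partial_def
    by (simp add: field_differentiable_derivI)
  then have "((\<lambda>s. (\<lambda>s. g (x + s *\<^sub>R axis c 1)) (s + t)) has_field_derivative
      partial c g (x + t *\<^sub>R axis c 1)) (at 0)"
    by (simp add: algebra_simps)
  then show ?thesis
    by (subst (asm) DERIV_shift[symmetric]) simp
qed

text \<open>Derivatives of a derivative are derivatives along the concatenated list. The bound on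
  \<open>length ks\<close> is strict, so the remaining order is at least 1 and the induction for
  Taylor's formula applies to \<open>iter_partial ks g\<close>.\<close>

lemma C_locally_at_iter_partial:
  assumes "C_locally_at r g x" "length ks < r"
  shows "C_locally_at (r - length ks) (iter_partial ks g) x"
proof -
  obtain U where "open U" "x \<in> U"
    and 1: "\<And>js. length js < r \<Longrightarrow> continuous_on U (iter_partial js g)"
    and 2: "\<And>js i y. length js < r \<Longrightarrow> y \<in> U \<Longrightarrow> has_partial i (iter_partial js g) y"
    and 3: "\<And>js. length js = r \<Longrightarrow> isCont (iter_partial js g) x"
    using assms(1) unfolding C_locally_at_def by blast
  with assms(2) show ?thesis
    unfolding C_locally_at_def iter_partial_append[symmetric]
    by (intro exI[of _ U]) auto
qed

lemma C_locally_at_isCont: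
  assumes "C_locally_at r g x" "length js \<le> r"
  shows "isCont (iter_partial js g) x"
proof (cases "length js = r")
  case False
  then have "length js < r" using assms(2) by simp
  with assms(1) show ?thesis
    unfolding C_locally_at_def by (meson continuous_on_eq_continuous_at)
qed (use assms(1) in \<open>auto simp: C_locally_at_def\<close>)

text \<open>As \<open>A\<close> grows from the empty set to all coordinates,
  \<open>x + coord_restrict A y\<close> moves from \<open>x\<close> to \<open>x + y\<close>,
  changing one coordinate at a time.\<close>

definition coord_restrict :: "'n set \<Rightarrow> real ^ 'n \<Rightarrow> real ^ 'n" where
  "coord_restrict A y = (\<chi> i. if i \<in> A then y $ i else 0)"

text \<open>\<open>mixed_partial\<close> with an arbitrary list in place of \<open>coords\<close>,
  so that induction over the list is possible.\<close>

definition sub_partial :: "'n list \<Rightarrow> nat ^ 'n \<Rightarrow> (real ^ 'n \<Rightarrow> real) \<Rightarrow> real ^ 'n \<Rightarrow> real" where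
  "sub_partial cs h f = iter_partial (concat (map (\<lambda>i. replicate (h $ i) i) cs)) f"

text \<open>This is the Lagrange form of Taylor's formula along direction \<open>c\<close>. The
  coefficients of order below \<open>s\<close> stay at the base point
  \<open>x + coord_restrict A y\<close>. In the term of order \<open>s\<close>, continuity at
  \<open>x\<close> allows the value at the intermediate point to be replaced by the value at
  \<open>x\<close>.\<close>

lemma coord_taylor:
  assumes C: "C_locally_at s g x" and s: "s \<ge> 1" and c: "c \<notin> A"
  shows "(\<lambda>y. g (x + coord_restrict (insert c A) y)
      - ((\<Sum>j<s. iter_partial (replicate j c) g (x + coord_restrict A y) / fact j * y $ c ^ j)
         + iter_partial (replicate s c) g x / fact s * y $ c ^ s))
    \<in> o[nhds 0](\<lambda>y. norm y ^ s)"
proof (rule landau_o.smallI)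
  fix e :: real assume e: "e > 0"
  obtain U where U: "open U" "x \<in> U"
    and diff: "\<And>js i y. length js < s \<Longrightarrow> y \<in> U \<Longrightarrow> has_partial i (iter_partial js g) y"
    using C unfolding C_locally_at_def by blast
  let ?D = "\<lambda>m. iter_partial (replicate m c) g"
  obtain d1 where d1: "d1 > 0" "\<And>y. dist y x < d1 \<Longrightarrow> y \<in> U"
    using U openE by (metis open_dist)
  have "isCont (?D s) x"
    by (rule C_locally_at_isCont[OF C]) simp
  then obtain d2 where d2: "d2 > 0" "\<And>y. dist y x < d2 \<Longrightarrow> dist (?D s y) (?D s x) < e"
    using e unfolding continuous_at_eps_delta by (metis)
  \<comment> \<open>\<open>d1\<close> keeps the points inside \<open>U\<close>, where the
    derivatives exist; \<open>d2\<close> controls the derivative of order \<open>s\<close>.\<close>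
  define d where "d = min d1 d2"
  have "\<bar>g (x + coord_restrict (insert c A) y)
      - ((\<Sum>j<s. ?D j (x + coord_restrict A y) / fact j * y $ c ^ j)
         + ?D s x / fact s * y $ c ^ s)\<bar> \<le> e * norm y ^ s"
    if y: "norm y < d" for y
  proof -
    define x' where "x' = x + coord_restrict A y"
    \<comment> \<open>Since \<open>c\<close> lies outside \<open>A\<close>, no component of the
      displacement exceeds that of \<open>y\<close> in absolute value.\<close>
    have near: "dist (x' + t *\<^sub>R axis c 1) x < d" if t: "\<bar>t\<bar> \<le> \<bar>y $ c\<bar>" for t
    proof -
      have "norm (coord_restrict A y + t *\<^sub>R axis c 1) \<le> norm y"
        by (rule norm_le_componentwise_cart)
          (use t c in \<open>auto simp: coord_restrict_def axis_def\<close>)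
      then show ?thesis using y by (simp add: x'_def dist_norm)
    qed
    \<comment> \<open>\<open>y $ c\<close> may have either sign, hence the two-sided Maclaurin
      formula.\<close>
    have "\<exists>t. \<bar>t\<bar> \<le> \<bar>y $ c\<bar> \<and> (\<lambda>t. g (x' + t *\<^sub>R axis c 1)) (y $ c) =
      (\<Sum>m<s. (\<lambda>m t. ?D m (x' + t *\<^sub>R axis c 1)) m 0 / fact m * y $ c ^ m)
      + (\<lambda>m t. ?D m (x' + t *\<^sub>R axis c 1)) s t / fact s * y $ c ^ s"
    proof (rule Maclaurin_bi_le, goal_cases)
      case 2
      show ?case
      proof (intro allI impI, elim conjE)
        fix m t assume m: "m < s" and t: "\<bar>t\<bar> \<le> \<bar>y $ c\<bar>"
        have "x' + t *\<^sub>R axis c 1 \<in> U"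
          using near[OF t] d1 by (auto simp: d_def)
        then have "has_partial c (?D m) (x' + t *\<^sub>R axis c 1)"
          using diff m by simp
        from has_partial_imp_DERIV[OF this]
        show "((\<lambda>t. ?D m (x' + t *\<^sub>R axis c 1)) has_real_derivative
            ?D (Suc m) (x' + t *\<^sub>R axis c 1)) (at t)"
          by (simp add: iter_partial_def)
      qed
    qed simp
    then obtain t where t: "\<bar>t\<bar> \<le> \<bar>y $ c\<bar>" and eq: "g (x' + (y $ c) *\<^sub>R axis c 1) =
      (\<Sum>m<s. ?D m x' / fact m * y $ c ^ m)
      + ?D s (x' + t *\<^sub>R axis c 1) / fact s * y $ c ^ s" by auto
    have "x' + (y $ c) *\<^sub>R axis c 1 = x + coord_restrict (insert c A) y"
      using c by (auto simp: vec_eq_iff x'_def coord_restrict_def axis_def)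
    with eq have "g (x + coord_restrict (insert c A) y)
      - ((\<Sum>j<s. ?D j x' / fact j * y $ c ^ j) + ?D s x / fact s * y $ c ^ s)
      = (?D s (x' + t *\<^sub>R axis c 1) - ?D s x) / fact s * y $ c ^ s"
      by (simp add: field_simps)
    also have "\<bar>\<dots>\<bar> = \<bar>?D s (x' + t *\<^sub>R axis c 1) - ?D s x\<bar> / fact s * \<bar>y $ c\<bar> ^ s"
      by (simp add: abs_mult power_abs)
    also have "\<dots> \<le> e * norm y ^ s"
    proof (intro mult_mono power_mono)
      have "\<bar>?D s (x' + t *\<^sub>R axis c 1) - ?D s x\<bar> \<le> e"
        using d2(2)[of "x' + t *\<^sub>R axis c 1"] near[OF t] by (simp add: dist_norm d_def)
      also have "e \<le> e * fact s"
        using e fact_ge_1[of s, where 'a = real] by (simp add: mult_le_cancel_left1)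
      finally show "\<bar>?D s (x' + t *\<^sub>R axis c 1) - ?D s x\<bar> / fact s \<le> e"
        by (simp add: divide_le_eq)
    qed (use e in \<open>auto simp: component_le_norm_cart\<close>)
    finally show ?thesis by (simp add: x'_def)
  qed
  moreover have "\<forall>\<^sub>F y in nhds 0. norm (y::real^'n) < d"
    using d1 d2 unfolding eventually_nhds_metric by (intro exI[of _ d]) (auto simp: d_def)
  ultimately show "\<forall>\<^sub>F y in nhds 0. norm (g (x + coord_restrict (insert c A) y)
      - ((\<Sum>j<s. ?D j (x + coord_restrict A y) / fact j * y $ c ^ j)
         + ?D s x / fact s * y $ c ^ s)) \<le> e * norm (norm y ^ s)"
    by (auto elim!: eventually_mono)
qed

lemma sub_partial_0 [simp]: "sub_partial cs 0 g = g"
proof -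
  have "concat (map (\<lambda>i. replicate 0 i) cs) = []" by (induction cs) auto
  then show ?thesis by (simp only: sub_partial_def zero_index iter_partial_Nil)
qed

text \<open>The last block of the list acts first on \<open>g\<close>; this matches expanding in the
  last coordinate first.\<close>

lemma sub_partial_snoc:
  assumes "c \<notin> set cs" "h $ c = 0"
  shows "sub_partial (cs @ [c]) (h + axis c j) g = sub_partial cs h (iter_partial (replicate j c) g)"
proof -
  have "map (\<lambda>i. replicate ((h + axis c j) $ i) i) cs = map (\<lambda>i. replicate (h $ i) i) cs"
    using assms(1) by (auto simp: axis_def)
  moreover have "(h + axis c j) $ c = j" using assms(2) by (simp add: axis_def)
  ultimately show ?thesis
    unfolding sub_partial_def by (simp only: map_append concat_append) (simp add: iter_partial_append)
qed

definition multi_indices_on :: "'n set \<Rightarrow> nat \<Rightarrow> (nat ^ 'n) set" where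
  "multi_indices_on A r = {h. mi_order h \<le> r \<and> (\<forall>i. i \<notin> A \<longrightarrow> h $ i = 0)}"

lemma finite_multi_indices_on: "finite (multi_indices_on A r)"
  by (rule finite_subset[OF _ finite_mi_order_le[of r]]) (auto simp: multi_indices_on_def)

lemma multi_indices_on_0 [simp]: "multi_indices_on A 0 = {0}"
  by (auto simp: multi_indices_on_def mi_order_eq_0_iff)

text \<open>A multi-index on \<open>insert c A\<close> splits uniquely into its component
  \<open>j\<close> at \<open>c\<close> and a multi-index on \<open>A\<close>, for which order at
  most \<open>r - j\<close> remains.\<close>

lemma sum_multi_indices_on_insert:
  fixes F :: "nat ^ 'n \<Rightarrow> real"
  assumes "c \<notin> A"
  shows "(\<Sum>h\<in>multi_indices_on (insert c A) r. F h) =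
    (\<Sum>j\<le>r. \<Sum>h\<in>multi_indices_on A (r - j). F (h + axis c j))"
proof -
  have "(\<Sum>j\<le>r. \<Sum>h\<in>multi_indices_on A (r - j). F (h + axis c j)) =
    (\<Sum>(j, h)\<in>Sigma {..r} (\<lambda>j. multi_indices_on A (r - j)). F (h + axis c j))"
    by (rule sum.Sigma) (auto simp: finite_multi_indices_on)
  also have "\<dots> = (\<Sum>h\<in>multi_indices_on (insert c A) r. F h)"
  proof (rule sum.reindex_bij_witness[where
        i = "\<lambda>h. (h $ c, \<chi> i. if i = c then 0 else h $ i)" and j = "\<lambda>(j, h). h + axis c j"])
    fix h :: "nat ^ 'n" assume h: "h \<in> multi_indices_on (insert c A) r"
    define h' where "h' = (\<chi> i. if i = c then 0 else h $ i)"
    have eq: "h = h' + axis c (h $ c)"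
      by (auto simp: h'_def vec_eq_iff axis_def)
    then show "(\<lambda>(j, h). h + axis c j) (h $ c, \<chi> i. if i = c then 0 else h $ i) = h"
      by (simp add: h'_def)
    have "mi_order h = mi_order h' + h $ c"
      by (subst eq) (simp add: mi_order_add)
    then show "(h $ c, \<chi> i. if i = c then 0 else h $ i) \<in> Sigma {..r} (\<lambda>j. multi_indices_on A (r - j))"
      using h unfolding h'_def[symmetric] by (auto simp: multi_indices_on_def h'_def)
  qed (use assms in \<open>auto simp: multi_indices_on_def mi_order_add\<close>,
      auto simp: multi_indices_on_def vec_eq_iff axis_def)
  finally show ?thesis by simp
qed

text \<open>Induction on the number of coordinates. \<open>coord_taylor\<close> expands in the last
  coordinate \<open>c\<close>; its coefficients of order \<open>j < r\<close> are then expanded in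
  the other coordinates to order \<open>r - j\<close> by the induction hypothesis, and the one of
  order \<open>r\<close> is already taken at \<open>x\<close>.\<close>

lemma taylor_coords:
  fixes g :: "real ^ 'n \<Rightarrow> real"
  assumes "distinct cs" "C_locally_at r g x" "r \<ge> 1"
  shows "(\<lambda>y. g (x + coord_restrict (set cs) y)
      - (\<Sum>h\<in>multi_indices_on (set cs) r. sub_partial cs h g x / mi_fact h * vpow y h))
    \<in> o[nhds 0](\<lambda>y. norm y ^ r)"
  using assms
proof (induction cs arbitrary: g r rule: rev_induct)
  case Nil
  have "multi_indices_on {} r = {0 :: nat ^ 'n}"
    by (auto simp: multi_indices_on_def vec_eq_iff)
  moreover have "coord_restrict {} y = 0" for y :: "real ^ 'n"
    by (simp add: coord_restrict_def vec_eq_iff)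
  ultimately show ?case by (simp add: sub_partial_def)
next
  case (snoc c cs)
  let ?A = "set cs"
  let ?D = "\<lambda>j. iter_partial (replicate j c) g"
  let ?P = "\<lambda>j y. \<Sum>h\<in>multi_indices_on ?A (r - j). sub_partial cs h (?D j) x / mi_fact h * vpow y h"
  have c: "c \<notin> ?A" "distinct cs" using snoc.prems by auto
  \<comment> \<open>The factor \<open>y $ c ^ j\<close> restores the \<open>j\<close> orders that
    the expansion of the coefficient lacks.\<close>
  have lower: "(\<lambda>y. (?D j (x + coord_restrict ?A y) - ?P j y) * (y $ c ^ j / fact j))
      \<in> o[nhds 0](\<lambda>y. norm y ^ r)" if j: "j < r" for j
  proof -
    have "(\<lambda>y. ?D j (x + coord_restrict ?A y) - ?P j y) \<in> o[nhds 0](\<lambda>y. norm y ^ (r - j))"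
      using C_locally_at_iter_partial[OF snoc.prems(2), of "replicate j c"] j c(2)
      by (intro snoc.IH) auto
    moreover have "(\<lambda>y::real^'n. y $ c ^ j / fact j) \<in> O[nhds 0](\<lambda>y. norm y ^ j)"
    proof (rule bigoI[of _ 1], rule always_eventually, rule allI)
      fix y :: "real ^ 'n"
      have "\<bar>y $ c\<bar> ^ j / fact j \<le> \<bar>y $ c\<bar> ^ j / 1"
        by (rule divide_left_mono) (auto intro: fact_ge_1)
      also have "\<dots> \<le> norm y ^ j"
        by (simp add: power_mono component_le_norm_cart)
      finally show "norm (y $ c ^ j / fact j) \<le> 1 * norm (norm y ^ j)"
        by (simp add: power_abs)
    qed
    ultimately have "(\<lambda>y. (?D j (x + coord_restrict ?A y) - ?P j y) * (y $ c ^ j / fact j))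
      \<in> o[nhds 0](\<lambda>y. norm y ^ (r - j) * norm y ^ j)"
      by (rule landau_o.small_big_mult)
    then show ?thesis using j by (simp add: power_add[symmetric])
  qed
  have poly: "(\<Sum>h\<in>multi_indices_on (set (cs @ [c])) r. sub_partial (cs @ [c]) h g x / mi_fact h * vpow y h)
      = (\<Sum>j<r. ?P j y * (y $ c ^ j / fact j)) + ?D r x / fact r * y $ c ^ r" for y
  proof -
    have "(\<Sum>h\<in>multi_indices_on (insert c ?A) r. sub_partial (cs @ [c]) h g x / mi_fact h * vpow y h)
      = (\<Sum>j\<le>r. ?P j y * (y $ c ^ j / fact j))"
      unfolding sum_multi_indices_on_insert[OF c(1)] sum_distrib_right
    proof (intro sum.cong refl)
      fix j and h :: "nat ^ 'n" assume "h \<in> multi_indices_on ?A (r - j)"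
      then have "h $ c = 0" using c by (auto simp: multi_indices_on_def)
      then show "sub_partial (cs @ [c]) (h + axis c j) g x / mi_fact (h + axis c j) * vpow y (h + axis c j)
        = sub_partial cs h (?D j) x / mi_fact h * vpow y h * (y $ c ^ j / fact j)"
        using c by (simp add: sub_partial_snoc mi_fact_add_axis vpow_add vpow_axis)
    qed
    \<comment> \<open>For \<open>j = r\<close> only the zero multi-index remains, so
      \<open>?P r y\<close> is the constant \<open>?D r x\<close>.\<close>
    also have "\<dots> = (\<Sum>j<r. ?P j y * (y $ c ^ j / fact j)) + ?P r y * (y $ c ^ r / fact r)"
      by (simp add: lessThan_Suc_atMost[symmetric])
    finally show ?thesis
      by simp
  qed
  \<comment> \<open>The error of the step in direction \<open>c\<close> and the weighted errors of
    its coefficients add up to the full remainder.\<close>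
  have "(\<lambda>y. (g (x + coord_restrict (insert c ?A) y)
      - ((\<Sum>j<r. ?D j (x + coord_restrict ?A y) / fact j * y $ c ^ j) + ?D r x / fact r * y $ c ^ r))
      + (\<Sum>j<r. (?D j (x + coord_restrict ?A y) - ?P j y) * (y $ c ^ j / fact j)))
    \<in> o[nhds 0](\<lambda>y. norm y ^ r)"
    using lower snoc.prems c by (intro sum_in_smallo big_sum_in_smallo coord_taylor) auto
  moreover have "(g (x + coord_restrict (insert c ?A) y)
      - ((\<Sum>j<r. ?D j (x + coord_restrict ?A y) / fact j * y $ c ^ j) + ?D r x / fact r * y $ c ^ r))
      + (\<Sum>j<r. (?D j (x + coord_restrict ?A y) - ?P j y) * (y $ c ^ j / fact j))
    = g (x + coord_restrict (set (cs @ [c])) y)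
      - (\<Sum>h\<in>multi_indices_on (set (cs @ [c])) r. sub_partial (cs @ [c]) h g x / mi_fact h * vpow y h)" for y
    unfolding poly by (simp add: left_diff_distrib diff_divide_distrib sum_subtractf)
  ultimately show ?case by (simp only:)
qed

lemma coords_enumerate: "distinct (coords :: 'n::finite list)" "set (coords :: 'n list) = UNIV"
proof -
  have "\<exists>js :: 'n list. distinct js \<and> set js = UNIV"
    using finite_distinct_list[of "UNIV :: 'n set"] by auto
  then have "distinct (coords :: 'n list) \<and> set (coords :: 'n list) = UNIV"
    unfolding coords_def by (rule someI_ex)
  then show "distinct (coords :: 'n list)" "set (coords :: 'n list) = UNIV" by auto
qed

lemma multivariate_taylor_peano:
  fixes g :: "real ^ 'n \<Rightarrow> real"
  assumes "C_locally_at r g x" "r \<ge> 1"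
  shows "(\<lambda>y. g (x + y) - (\<Sum>h | mi_order h \<le> r. mixed_partial h g x / mi_fact h * vpow y h))
    \<in> o[nhds 0](\<lambda>y. norm y ^ r)"
proof -
  have "coord_restrict UNIV y = y" for y :: "real ^ 'n"
    by (simp add: coord_restrict_def vec_eq_iff)
  then show ?thesis
    using taylor_coords[OF coords_enumerate(1) assms]
    by (simp add: coords_enumerate(2) multi_indices_on_def sub_partial_def mixed_partial_def)
qed

subsection \<open>Norms and componentwise scaling\<close>

lemma power_add_le_two_power:
  fixes a b :: real
  assumes "a \<ge> 0" "b \<ge> 0"
  shows "(a + b) ^ r \<le> 2 ^ r * (a ^ r + b ^ r)"
proof -
  have "(a + b) ^ r \<le> (2 * max a b) ^ r"
    using assms by (intro power_mono) auto
  also have "\<dots> = 2 ^ r * max a b ^ r" by (rule power_mult_distrib)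
  also have "\<dots> \<le> 2 ^ r * (a ^ r + b ^ r)"
    using assms by (intro mult_left_mono) (auto simp: max_def)
  finally show ?thesis .
qed

text \<open>The norm is at most N times the largest component, and the power of that component is
  one term of the sum. Thus moments of the pure powers \<open>axis i r\<close> control powers of the
  norm.\<close>

lemma norm_power_le_sum_component:
  fixes x :: "real ^ 'n"
  shows "norm x ^ r \<le> real CARD('n) ^ r * (\<Sum>i\<in>UNIV. \<bar>x $ i\<bar> ^ r)"
proof -
  define M where "M = Max (range (\<lambda>i. \<bar>x $ i\<bar>))"
  have "M \<in> range (\<lambda>i. \<bar>x $ i\<bar>)" unfolding M_def by (rule Max_in) auto
  then obtain l where l: "M = \<bar>x $ l\<bar>" by auto
  have "norm x \<le> (\<Sum>i\<in>UNIV. \<bar>x $ i\<bar>)" by (rule norm_le_l1_cart)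
  also have "\<dots> \<le> (\<Sum>i\<in>(UNIV::'n set). M)"
    by (intro sum_mono) (auto simp: M_def)
  finally have "norm x ^ r \<le> (real CARD('n) * \<bar>x $ l\<bar>) ^ r"
    by (intro power_mono) (auto simp: l)
  also have "\<dots> = real CARD('n) ^ r * \<bar>x $ l\<bar> ^ r" by (rule power_mult_distrib)
  also have "\<dots> \<le> real CARD('n) ^ r * (\<Sum>i\<in>UNIV. \<bar>x $ i\<bar> ^ r)"
    by (intro mult_left_mono member_le_sum) auto
  finally show ?thesis .
qed

section \<open>Componentwise division and the affine change of variables\<close>

definition vinv :: "real ^ 'n \<Rightarrow> real ^ 'n" where
  "vinv q = (\<chi> i. inverse (q $ i))"

lemma vpow_vinv_mult: "vpow (vinv q * y) h = vpow y h / vpow q h"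
proof -
  have "(vinv q * y) $ i = y $ i / q $ i" for i by (simp add: vinv_def divide_inverse)
  then show ?thesis unfolding vpow_def by (simp only: power_divide prod_dividef)
qed

lemma vprod_vinv: "vprod (vinv q) = inverse (vprod q)"
  unfolding vprod_def vinv_def vec_lambda_beta by (rule prod_inversef[of "($) q", unfolded o_def])

text \<open>The anisotropic scaling by \<open>q\<close> is compared with the scalar
  \<open>m\<close>, a lower bound for all its components.\<close>

lemma norm_vinv_mult_le:
  assumes "m > 0" "\<And>i. m \<le> q $ i"
  shows "norm (vinv q * y) * m \<le> norm y"
proof -
  have "norm (vinv q * y) \<le> norm (inverse m *\<^sub>R y)"
  proof (rule norm_le_componentwise_cart)
    fix i
    have "m \<le> q $ i" by (rule assms)
    then have "inverse (q $ i) \<le> inverse m" "q $ i > 0" using assms(1) by (auto intro: le_imp_inverse_le)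
    then show "norm ((vinv q * y) $ i) \<le> norm ((inverse m *\<^sub>R y) $ i)"
      using assms(1) by (simp add: vinv_def abs_mult mult_right_mono)
  qed
  then show ?thesis using assms(1) by (simp add: field_simps)
qed

text \<open>The affine transformation of Lebesgue measure is carried over from coordinates with
  respect to \<open>Basis\<close> to componentwise products. The Jacobian is \<open>vprod c\<close>
  itself because all components are positive.\<close>

lemma
  fixes c d :: "real ^ 'n"
  assumes c: "\<And>i. c $ i > 0"
  shows measurable_affine_cart: "(\<lambda>t. d + c * t) \<in> lebesgue \<rightarrow>\<^sub>M lebesgue"
    and integral_affine_cart: "h \<in> borel_measurable lebesgue \<Longrightarrow>
      vprod c * (LINT t|lebesgue. h (d + c * t)) = (LINT u|lebesgue. h u :: real)"
proof -
  have Basis: "(Basis :: (real ^ 'n) set) = (\<lambda>i. axis i 1) ` UNIV"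
    by (auto simp: Basis_vec_def)
  have inj: "inj (\<lambda>i. axis i (1::real) :: real ^ 'n)"
    by (auto simp: inj_on_def axis_eq_axis)
  have T: "d + c * t = d + (\<Sum>j\<in>Basis. ((c \<bullet> j) * (t \<bullet> j)) *\<^sub>R j)" for t
  proof -
    have "(\<Sum>j\<in>Basis. ((c \<bullet> j) * (t \<bullet> j)) *\<^sub>R j) = (\<Sum>i\<in>UNIV. (c $ i * t $ i) *\<^sub>R axis i 1)"
      unfolding Basis by (subst sum.reindex[OF inj]) (simp add: inner_axis)
    also have "\<dots> = c * t"
      by (simp add: vec_eq_iff axis_def if_distrib[of "(*) _"] cong: if_cong)
    finally show ?thesis by simp
  qed
  have cB: "c \<bullet> j \<noteq> 0" if "j \<in> Basis" for j
    using that c by (auto simp: Basis inner_axis less_imp_neq[symmetric])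
  have pr: "(\<Prod>j\<in>Basis. \<bar>c \<bullet> j\<bar>) = vprod c"
    unfolding Basis vprod_def using c
    by (subst prod.reindex[OF inj]) (auto simp: inner_axis less_imp_le)
  show M: "(\<lambda>t. d + c * t) \<in> lebesgue \<rightarrow>\<^sub>M lebesgue"
    unfolding T by (rule lebesgue_affine_measurable) (rule cB)
  assume h: "h \<in> borel_measurable lebesgue"
  have leb: "lebesgue = density (distr lebesgue lebesgue (\<lambda>t. d + c * t)) (\<lambda>_. ennreal (vprod c))"
    using lebesgue_affine_euclidean[of "\<lambda>j. c \<bullet> j" d, OF cB] unfolding T pr .
  have pos: "vprod c \<ge> 0" unfolding vprod_def using c by (simp add: prod_nonneg less_imp_le)
  have "(LINT u|lebesgue. h u) = (LINT u|density (distr lebesgue lebesgue (\<lambda>t. d + c * t)) (\<lambda>_. ennreal (vprod c)). h u)"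
    using leb by simp
  also have "\<dots> = (LINT u|distr lebesgue lebesgue (\<lambda>t. d + c * t). vprod c *\<^sub>R h u)"
    by (rule integral_density) (use h pos in auto)
  also have "\<dots> = (LINT t|lebesgue. vprod c *\<^sub>R h (d + c * t))"
    by (rule integral_distr[OF M]) (use h in auto)
  finally show "vprod c * (LINT t|lebesgue. h (d + c * t)) = (LINT u|lebesgue. h u)" by simp
qed

lemma measurable_vinv_affine:
  assumes "\<And>i. q $ i > 0"
  shows "(\<lambda>t. x + vinv q * (t - v)) \<in> lebesgue \<rightarrow>\<^sub>M lebesgue"
proof -
  have "(\<lambda>t. (x - vinv q * v) + vinv q * t) \<in> lebesgue \<rightarrow>\<^sub>M lebesgue"
    by (rule measurable_affine_cart) (use assms in \<open>simp add: vinv_def\<close>)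
  then show ?thesis by (simp add: algebra_simps)
qed

lemma durrmeyer_eq:
  assumes q: "\<And>i. q $ i > 0" and [measurable]: "\<psi> \<in> borel_measurable lebesgue" "f \<in> borel_measurable lebesgue"
  shows "durrmeyer \<phi> \<psi> q f x = (\<Sum>\<^sub>\<infinity>k. \<phi> (q * x - lattice_pt k) *
    (LINT t|lebesgue. \<psi> t * f (x + vinv q * (t - (q * x - lattice_pt k)))))"
proof -
  have qv: "vprod q > 0" unfolding vprod_def using q by (simp add: prod_pos)
  have "vprod q * (LINT u|lebesgue. \<psi> (q * u - k) * f u)
    = (LINT t|lebesgue. \<psi> t * f (x + vinv q * (t - (q * x - k))))" for k
  proof -
    have [measurable]: "(\<lambda>u. q * u - k) \<in> lebesgue \<rightarrow>\<^sub>M lebesgue"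
      using measurable_affine_cart[OF q, of "- k"] by simp
    have vi: "vinv q $ i > 0" for i using q by (simp add: vinv_def)
    \<comment> \<open>The substituted point \<open>u = (k + t)/q\<close> is written around
      \<open>x\<close>, ready for a Taylor expansion there.\<close>
    have 1: "vinv q * k + vinv q * t = x + vinv q * (t - (q * x - k))"
      and 2: "q * (vinv q * k + vinv q * t) - k = t" for t
      using q[THEN less_imp_neq] by (auto simp: vec_eq_iff vinv_def field_simps)
    have "(\<lambda>u. \<psi> (q * u - k) * f u) \<in> borel_measurable lebesgue" by measurable
    from integral_affine_cart[OF vi this, of "vinv q * k"]
    have "(LINT u|lebesgue. \<psi> (q * u - k) * f u) =
      inverse (vprod q) * (LINT t|lebesgue. \<psi> t * f (x + vinv q * (t - (q * x - k))))"
      unfolding 2 unfolding 1 vprod_vinv by simp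
    then show ?thesis using qv by simp
  qed
  then show ?thesis unfolding durrmeyer_def by simp
qed

text \<open>Only integrals of \<open>f\<close> enter the operator. Hence an essentially bounded
  \<open>f\<close> may be replaced by a version that is bounded everywhere.\<close>

lemma durrmeyer_cong_AE:
  assumes q: "\<And>i. q $ i > 0" and [measurable]: "\<psi> \<in> borel_measurable lebesgue"
    "f \<in> borel_measurable lebesgue" "g \<in> borel_measurable lebesgue"
    and eq: "AE u in lebesgue. f u = g u"
  shows "durrmeyer \<phi> \<psi> q f x = durrmeyer \<phi> \<psi> q g x"
proof -
  have "(LINT u|lebesgue. \<psi> (q * u - k) * f u) = (LINT u|lebesgue. \<psi> (q * u - k) * g u)" for k
  proof (rule integral_cong_AE)
    have [measurable]: "(\<lambda>u. q * u - k) \<in> lebesgue \<rightarrow>\<^sub>M lebesgue"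
      using measurable_affine_cart[OF q, of "- k"] by simp
    show "(\<lambda>u. \<psi> (q * u - k) * f u) \<in> borel_measurable lebesgue"
      "(\<lambda>u. \<psi> (q * u - k) * g u) \<in> borel_measurable lebesgue" by measurable
  qed (use eq in auto)
  then show ?thesis unfolding durrmeyer_def by simp
qed

subsection \<open>The polynomial part\<close>

lemma borel_measurable_vpow [measurable]: "(\<lambda>t. vpow t h) \<in> borel_measurable borel"
  unfolding vpow_def by measurable

text \<open>The binomial formula is applied to \<open>- v + t\<close>. For \<open>v = u - k\<close>
  the power of \<open>- v\<close> is one of \<open>k - u\<close>, the sign convention of the
  discrete moments.\<close>

lemma integral_vpow_shift:
  fixes \<psi> :: "real ^ 'n \<Rightarrow> real"
  assumes int: "\<And>s. s \<le> h \<Longrightarrow> integrable lebesgue (\<lambda>t. vpow t s * \<psi> t)"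
  shows "integrable lebesgue (\<lambda>t. \<psi> t * vpow (vinv q * (t - v)) h)"
    and "(LINT t|lebesgue. \<psi> t * vpow (vinv q * (t - v)) h) =
      (\<Sum>s\<in>{s. s \<le> h}. real (mi_binom h s) * vpow (- v) (h - s) * cont_moment \<psi> s) / vpow q h"
proof -
  have eq: "\<psi> t * vpow (vinv q * (t - v)) h =
    (\<Sum>s\<in>{s. s \<le> h}. real (mi_binom h s) * vpow (- v) (h - s) * (vpow t s * \<psi> t)) / vpow q h" for t
    using vpow_add_binomial[of "- v" t h] by (simp add: vpow_vinv_mult sum_distrib_left mult_ac)
  show "integrable lebesgue (\<lambda>t. \<psi> t * vpow (vinv q * (t - v)) h)"
    unfolding eq using int by (intro integrable_divide_zero integrable_sum integrable_mult_right) auto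
  show "(LINT t|lebesgue. \<psi> t * vpow (vinv q * (t - v)) h) =
      (\<Sum>s\<in>{s. s \<le> h}. real (mi_binom h s) * vpow (- v) (h - s) * cont_moment \<psi> s) / vpow q h"
    unfolding eq cont_moment_def using int
    by (simp add: Bochner_Integration.integral_sum integrable_mult_right)
qed

lemma has_sum_sum:
  fixes g :: "'i \<Rightarrow> 'k \<Rightarrow> real"
  assumes "finite A" "\<And>i. i \<in> A \<Longrightarrow> (g i has_sum G i) B"
  shows "((\<lambda>k. \<Sum>i\<in>A. g i k) has_sum (\<Sum>i\<in>A. G i)) B"
  using assms by (induction A rule: finite_induct) (auto intro: has_sum_add)

text \<open>The sum over \<open>s\<close> is finite, so it may be exchanged with the series over
  \<open>k\<close>, which turns the powers of \<open>- v\<close> into discrete moments.\<close>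

lemma has_sum_vpow:
  fixes \<phi> \<psi> :: "real ^ 'n \<Rightarrow> real"
  assumes int: "\<And>s. s \<le> h \<Longrightarrow> integrable lebesgue (\<lambda>t. vpow t s * \<psi> t)"
    and dm: "\<And>s. s \<le> h \<Longrightarrow> (discrete_moment_term \<phi> s u has_sum M s) UNIV"
  shows "((\<lambda>k. \<phi> (u - lattice_pt k) * (LINT t|lebesgue. \<psi> t * vpow (vinv q * (t - (u - lattice_pt k))) h))
    has_sum (\<Sum>s\<in>{s. s \<le> h}. real (mi_binom h s) * M (h - s) * cont_moment \<psi> s) / vpow q h) UNIV"
proof -
  have le: "h - s \<le> h" for s :: "nat ^ 'n" by (simp add: less_eq_vec_def)
  have "((\<lambda>k. (\<Sum>s\<in>{s. s \<le> h}. real (mi_binom h s) * discrete_moment_term \<phi> (h - s) u k * cont_moment \<psi> s)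
      * (1 / vpow q h))
    has_sum (\<Sum>s\<in>{s. s \<le> h}. real (mi_binom h s) * M (h - s) * cont_moment \<psi> s) * (1 / vpow q h)) UNIV"
    by (intro has_sum_cmult_left has_sum_sum has_sum_cmult_right dm le finite_multi_index_le)
  then show ?thesis
    by (simp add: integral_vpow_shift(2)[OF int] discrete_moment_term_def sum_distrib_left sum_divide_distrib mult_ac)
qed

subsection \<open>Uniform bounds for the discrete kernel\<close>

text \<open>Unconditional summability of real families is absolute, so the moment terms of the pure
  powers \<open>axis i r\<close> already provide a summable majorant.\<close>

lemma norm_power_summable:
  fixes \<phi> :: "real ^ 'n \<Rightarrow> real"
  assumes "\<And>i. discrete_moment_term \<phi> (axis i r) u summable_on UNIV"
  shows "(\<lambda>k. \<bar>\<phi> (u - lattice_pt k)\<bar> * norm (u - lattice_pt k) ^ r) summable_on UNIV"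
proof -
  have comp: "(\<lambda>k. \<bar>\<phi> (u - lattice_pt k)\<bar> * \<bar>(u - lattice_pt k) $ i\<bar> ^ r) summable_on UNIV" for i
  proof -
    have "(\<lambda>k. norm (discrete_moment_term \<phi> (axis i r) u k)) summable_on UNIV"
      using assms summable_on_iff_abs_summable_on_real by blast
    then show ?thesis
      by (simp add: discrete_moment_term_def vpow_axis abs_mult power_abs abs_minus_commute)
  qed
  have "(\<lambda>k. \<Sum>i\<in>UNIV. \<bar>\<phi> (u - lattice_pt k)\<bar> * \<bar>(u - lattice_pt k) $ i\<bar> ^ r) summable_on UNIV"
    by (rule has_sum_imp_summable, rule has_sum_sum, simp, rule has_sum_infsum, rule comp)
  then have "(\<lambda>k. real CARD('n) ^ r * (\<Sum>i\<in>UNIV. \<bar>\<phi> (u - lattice_pt k)\<bar> * \<bar>(u - lattice_pt k) $ i\<bar> ^ r)) summable_on UNIV"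
    by (rule summable_on_cmult_right)
  then show ?thesis
  proof (rule summable_on_comparison_test)
    fix k
    have "\<bar>\<phi> (u - lattice_pt k)\<bar> * norm (u - lattice_pt k) ^ r
      \<le> \<bar>\<phi> (u - lattice_pt k)\<bar> * (real CARD('n) ^ r * (\<Sum>i\<in>UNIV. \<bar>(u - lattice_pt k) $ i\<bar> ^ r))"
      by (intro mult_left_mono norm_power_le_sum_component) auto
    then show "\<bar>\<phi> (u - lattice_pt k)\<bar> * norm (u - lattice_pt k) ^ r \<le>
      real CARD('n) ^ r * (\<Sum>i\<in>UNIV. \<bar>\<phi> (u - lattice_pt k)\<bar> * \<bar>(u - lattice_pt k) $ i\<bar> ^ r)"
      by (simp add: sum_distrib_left mult_ac)
  qed auto
qed

text \<open>Translation by the integer part of \<open>u\<close> moves all lattice points of the ball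
  into one box that does not depend on \<open>u\<close>.\<close>

lemma lattice_ball_card_bound:
  "\<exists>M. \<forall>u :: real ^ 'n. finite {k. norm (u - lattice_pt k) \<le> w} \<and> card {k. norm (u - lattice_pt k) \<le> w} \<le> M"
proof -
  \<comment> \<open>The margin 1 absorbs the fractional parts of \<open>u\<close>.\<close>
  define L where "L = {k :: int ^ 'n. \<forall>i. k $ i \<in> {-\<lceil>w\<rceil> - 1..\<lceil>w\<rceil> + 1}}"
  have L: "finite L" unfolding L_def by (rule finite_vec_box) simp
  have "finite {k. norm (u - lattice_pt k) \<le> w} \<and> card {k. norm (u - lattice_pt k) \<le> w} \<le> card L" for u :: "real ^ 'n"
  proof -
    define z where "z = (\<chi> i. \<lfloor>u $ i\<rfloor>)"
    have sub: "(\<lambda>k. k - z) ` {k. norm (u - lattice_pt k) \<le> w} \<subseteq> L"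
    proof (rule image_subsetI)
      fix k assume k: "k \<in> {k. norm (u - lattice_pt k) \<le> w}"
      have "(k - z) $ i \<in> {-\<lceil>w\<rceil> - 1..\<lceil>w\<rceil> + 1}" for i
      proof -
        have "\<bar>(u - lattice_pt k) $ i\<bar> \<le> w"
          using k component_le_norm_cart order_trans by blast
        then have "\<bar>u $ i - real_of_int (k $ i)\<bar> \<le> w" by (simp add: lattice_pt_def)
        then show ?thesis by (simp add: z_def) linarith
      qed
      then show "k - z \<in> L" by (simp add: L_def)
    qed
    have inj: "inj_on (\<lambda>k. k - z) {k. norm (u - lattice_pt k) \<le> w}" by (auto simp: inj_on_def)
    show ?thesis
      using inj_on_finite[OF inj sub L] card_inj_on_le[OF inj sub L] by blast
  qed
  then show ?thesis by blast
qed

text \<open>A single radius \<open>w\<close> is fixed for which every tail is at most 1. Inside it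
  there are boundedly many lattice points and \<phi> is bounded; outside,
  \<open>1 + norm v ^ r\<close> is at most twice \<open>norm v ^ r\<close>.\<close>

lemma discrete_kernel_uniform_bound:
  fixes \<phi> :: "real ^ 'n \<Rightarrow> real"
  assumes bdd: "bounded (range \<phi>)"
    and sum0: "\<And>u. (\<lambda>k. \<bar>\<phi> (u - lattice_pt k)\<bar>) summable_on UNIV"
    and sumr: "\<And>u. (\<lambda>k. \<bar>\<phi> (u - lattice_pt k)\<bar> * norm (u - lattice_pt k) ^ r) summable_on UNIV"
    and tail: "uniform_limit UNIV
      (\<lambda>w u. \<Sum>\<^sub>\<infinity>k\<in>{k. norm (u - lattice_pt k) > w}. \<bar>\<phi> (u - lattice_pt k)\<bar> * norm (u - lattice_pt k) ^ r)
      (\<lambda>u. 0) at_top"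
  obtains D where "D \<ge> 0"
    "\<And>u. (\<Sum>\<^sub>\<infinity>k. \<bar>\<phi> (u - lattice_pt k)\<bar> * (1 + norm (u - lattice_pt k) ^ r)) \<le> D"
proof -
  obtain C where C: "\<And>v. \<bar>\<phi> v\<bar> \<le> C" using bdd by (auto simp: bounded_iff)
  then have C0: "C \<ge> 0" by (meson abs_ge_zero order_trans)
  have "\<forall>\<^sub>F w in at_top. \<forall>u\<in>UNIV. dist
      (\<Sum>\<^sub>\<infinity>k\<in>{k. norm (u - lattice_pt k) > w}. \<bar>\<phi> (u - lattice_pt k)\<bar> * norm (u - lattice_pt k) ^ r) 0 < 1"
    by (rule uniform_limitD[OF tail]) simp
  \<comment> \<open>The requirement \<open>w \<ge> 1\<close> ensures that \<open>norm v ^ r\<close>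
    is at least 1 on the tail.\<close>
  then have "\<forall>\<^sub>F w in at_top. w \<ge> 1 \<and> (\<forall>u\<in>UNIV. dist
      (\<Sum>\<^sub>\<infinity>k\<in>{k. norm (u - lattice_pt k) > w}. \<bar>\<phi> (u - lattice_pt k)\<bar> * norm (u - lattice_pt k) ^ r) 0 < 1)"
    by (intro eventually_conj eventually_ge_at_top)
  then obtain w where w: "w \<ge> 1" and "\<And>u. dist (\<Sum>\<^sub>\<infinity>k\<in>{k. norm (u - lattice_pt k) > w}.
      \<bar>\<phi> (u - lattice_pt k)\<bar> * norm (u - lattice_pt k) ^ r) 0 < 1"
    unfolding eventually_at_top_linorder by blast
  then have le1: "(\<Sum>\<^sub>\<infinity>k\<in>{k. norm (u - lattice_pt k) > w}.
      \<bar>\<phi> (u - lattice_pt k)\<bar> * norm (u - lattice_pt k) ^ r) \<le> 1" for u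
    by (metis (no_types, lifting) abs_le_D1 dist_0_norm dist_commute less_imp_le real_norm_def)
  obtain M where M: "\<And>u :: real ^ 'n. finite {k. norm (u - lattice_pt k) \<le> w}"
    "\<And>u :: real ^ 'n. card {k. norm (u - lattice_pt k) \<le> w} \<le> M"
    using lattice_ball_card_bound[of w] by blast
  have "(\<Sum>\<^sub>\<infinity>k. \<bar>\<phi> (u - lattice_pt k)\<bar> * (1 + norm (u - lattice_pt k) ^ r)) \<le> real M * (C * (1 + w ^ r)) + 2" for u
  proof -
    let ?S = "{k. norm (u - lattice_pt k) \<le> w}" and ?T = "{k. norm (u - lattice_pt k) > w}"
    let ?g = "\<lambda>k. \<bar>\<phi> (u - lattice_pt k)\<bar> * (1 + norm (u - lattice_pt k) ^ r)"
    let ?h = "\<lambda>k. \<bar>\<phi> (u - lattice_pt k)\<bar> * norm (u - lattice_pt k) ^ r"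
    have g: "?g summable_on A" for A
    proof (rule summable_on_subset_banach)
      show "?g summable_on UNIV"
        using summable_on_add[OF sum0[of u] sumr[of u]] by (simp add: algebra_simps)
    qed simp
    have h: "?h summable_on ?T" using sumr by (rule summable_on_subset_banach) simp
    have "(\<Sum>\<^sub>\<infinity>k. ?g k) = (\<Sum>\<^sub>\<infinity>k\<in>?S \<union> ?T. ?g k)"
      by (rule infsum_cong_neutral) auto
    also have "\<dots> = (\<Sum>\<^sub>\<infinity>k\<in>?S. ?g k) + (\<Sum>\<^sub>\<infinity>k\<in>?T. ?g k)"
      by (rule infsum_Un_disjoint[OF g g]) auto
    also have "(\<Sum>\<^sub>\<infinity>k\<in>?S. ?g k) = (\<Sum>k\<in>?S. ?g k)"
      using M(1) by simp
    also have "\<dots> \<le> (\<Sum>k\<in>?S. C * (1 + w ^ r))"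
      using C C0 w by (intro sum_mono mult_mono add_mono power_mono) auto
    also have "\<dots> \<le> real M * (C * (1 + w ^ r))"
      using M(2)[of u] C0 w by (auto intro!: mult_right_mono)
    also have "(\<Sum>\<^sub>\<infinity>k\<in>?T. ?g k) \<le> (\<Sum>\<^sub>\<infinity>k\<in>?T. 2 * ?h k)"
    proof (rule infsum_mono[OF g summable_on_cmult_right[OF h]])
      fix k assume "k \<in> ?T"
      then have "1 \<le> norm (u - lattice_pt k) ^ r" using w by (intro one_le_power) auto
      then have "\<bar>\<phi> (u - lattice_pt k)\<bar> * (1 + norm (u - lattice_pt k) ^ r)
        \<le> \<bar>\<phi> (u - lattice_pt k)\<bar> * (2 * norm (u - lattice_pt k) ^ r)"
        by (intro mult_left_mono) auto
      then show "?g k \<le> 2 * ?h k" by (simp add: mult_ac)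
    qed
    also have "\<dots> = 2 * (\<Sum>\<^sub>\<infinity>k\<in>?T. ?h k)" by (rule infsum_cmult_right) (rule h)
    also have "\<dots> \<le> 2" using le1[of u] by simp
    finally show ?thesis by simp
  qed
  moreover have "0 \<le> real M * (C * (1 + w ^ r)) + 2" using C0 w by simp
  ultimately show ?thesis using that by blast
qed

subsection \<open>The remainder\<close>

definition norm_tail :: "nat \<Rightarrow> (real ^ 'n \<Rightarrow> real) \<Rightarrow> real \<Rightarrow> real" where
  "norm_tail r \<psi> w = (LINT t|lebesgue. indicator {t. norm t > w} t * (norm t ^ r * \<bar>\<psi> t\<bar>))"

lemma sets_lebesgue_norm_gt: "{t :: real ^ 'n. norm t > w} \<in> sets lebesgue"
  using borel_open[OF open_Collect_less[OF continuous_on_const continuous_on_norm_id, of w]]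
  by (simp add: sets_completionI_sets)

text \<open>Dominated convergence: for each \<open>t\<close> the indicator vanishes as soon as
  \<open>w\<close> reaches \<open>norm t\<close>.\<close>

lemma norm_tail_tendsto_0:
  fixes \<psi> :: "real ^ 'n \<Rightarrow> real"
  assumes "integrable lebesgue (\<lambda>t. norm t ^ r * \<bar>\<psi> t\<bar>)"
  shows "(norm_tail r \<psi> \<longlongrightarrow> 0) at_top"
proof -
  have [measurable]: "(\<lambda>t. norm t ^ r * \<bar>\<psi> t\<bar>) \<in> borel_measurable lebesgue"
    using assms by (rule borel_measurable_integrable)
  have "((\<lambda>w. LINT t|lebesgue. indicator {t. norm t > w} t * (norm t ^ r * \<bar>\<psi> t\<bar>))
    \<longlongrightarrow> (LINT t|(lebesgue :: (real^'n) measure). 0)) at_top"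
  proof (rule integral_dominated_convergence_at_top[where w = "\<lambda>t. norm t ^ r * \<bar>\<psi> t\<bar>"])
    show "\<forall>\<^sub>F w in at_top. AE t in lebesgue. norm (indicator {t. norm t > w} t * (norm t ^ r * \<bar>\<psi> t\<bar>))
        \<le> norm t ^ r * \<bar>\<psi> t\<bar>"
      by (intro always_eventually allI AE_I2) (auto simp: indicator_def abs_mult)
    show "AE t in lebesgue. ((\<lambda>w. indicator {t. norm t > w} t * (norm t ^ r * \<bar>\<psi> t\<bar>)) \<longlongrightarrow> 0) at_top"
    proof (rule AE_I2, rule tendsto_eventually)
      fix t :: "real ^ 'n"
      show "\<forall>\<^sub>F w in at_top. indicator {t. norm t > w} t * (norm t ^ r * \<bar>\<psi> t\<bar>) = 0"
        using eventually_ge_at_top[of "norm t"] by eventually_elim auto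
    qed
    note sets_lebesgue_norm_gt [measurable]
    show "(\<lambda>t. indicator {t. norm t > w} t * (norm t ^ r * \<bar>\<psi> t\<bar>)) \<in> borel_measurable lebesgue" for w
      by measurable
  qed (use assms in auto)
  then show ?thesis unfolding norm_tail_def[abs_def] by simp
qed

text \<open>If \<open>v\<close> is large, the global bound is used and charged to the tail in
  \<open>v\<close>. If only \<open>t\<close> is large, it is charged to the tail in
  \<open>t\<close>. If both are at most \<open>\<delta> * m / 2\<close>, the argument of
  \<open>E\<close> has norm at most \<delta> and the local bound applies. The factor
  \<open>2 ^ r\<close> comes from splitting \<open>(norm t + norm v) ^ r\<close>.\<close>

lemma remainder_pointwise:
  fixes E :: "real ^ 'n \<Rightarrow> real"
  assumes m: "m > 0" "\<And>i. m \<le> q $ i" and eps: "\<epsilon> \<ge> 0" and K0: "K \<ge> 0"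
    and K: "\<And>y. \<bar>E y\<bar> \<le> K * norm y ^ r"
    and near: "\<And>y. norm y \<le> \<delta> \<Longrightarrow> \<bar>E y\<bar> \<le> \<epsilon> * norm y ^ r"
  shows "\<bar>E (vinv q * (t - v))\<bar> * m ^ r \<le> 2 ^ r * (
      (\<epsilon> + K * indicator {v. norm v > \<delta> * m / 2} v) * (norm t ^ r + norm v ^ r)
      + K * (indicator {t. norm t > \<delta> * m / 2} t * norm t ^ r))"
proof -
  let ?y = "vinv q * (t - v)" and ?W = "\<delta> * m / 2"
  have ym: "norm ?y * m \<le> norm (t - v)" by (rule norm_vinv_mult_le[OF m])
  have ymr: "norm ?y ^ r * m ^ r \<le> norm (t - v) ^ r"
    unfolding power_mult_distrib[symmetric] using ym m by (intro power_mono) auto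
  have tv: "norm (t - v) ^ r \<le> 2 ^ r * (norm t ^ r + norm v ^ r)"
    using power_mono[OF norm_triangle_ineq4[of t v] norm_ge_zero, of r]
      power_add_le_two_power[of "norm t" "norm v" r] by simp
  have gen: "\<bar>E ?y\<bar> * m ^ r \<le> c * norm (t - v) ^ r" if "\<bar>E ?y\<bar> \<le> c * norm ?y ^ r" "c \<ge> 0" for c
  proof -
    have "\<bar>E ?y\<bar> * m ^ r \<le> c * norm ?y ^ r * m ^ r"
      using that m by (intro mult_right_mono) auto
    also have "\<dots> \<le> c * norm (t - v) ^ r"
      using mult_left_mono[OF ymr that(2)] by (simp add: mult_ac)
    finally show ?thesis .
  qed
  consider "norm v > ?W" | "norm v \<le> ?W" "norm t > ?W" | "norm v \<le> ?W" "norm t \<le> ?W" by linarith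
  then show ?thesis
  proof cases
    case 1
    have "\<bar>E ?y\<bar> * m ^ r \<le> K * (2 ^ r * (norm t ^ r + norm v ^ r))"
      using gen[OF K K0] mult_left_mono[OF tv K0] by linarith
    also have "\<dots> = 2 ^ r * (K * (norm t ^ r + norm v ^ r))" by simp
    also have "\<dots> \<le> 2 ^ r * ((\<epsilon> + K) * (norm t ^ r + norm v ^ r)
        + K * (indicator {t. norm t > ?W} t * norm t ^ r))"
      using eps K0 by (intro mult_left_mono) (auto simp: distrib_right intro!: add_increasing2 add_increasing mult_nonneg_nonneg add_nonneg_nonneg)
    finally show ?thesis using 1 by simp
  next
    case 2
    \<comment> \<open>Here \<open>norm v\<close> is below \<open>norm t\<close>, so a power of
      \<open>t\<close> alone suffices and the bound is absorbed by the tail in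
      \<open>t\<close>.\<close>
    have "norm (t - v) ^ r \<le> (2 * norm t) ^ r"
      using norm_triangle_ineq4[of t v] 2 by (intro power_mono) auto
    then have "\<bar>E ?y\<bar> * m ^ r \<le> K * (2 * norm t) ^ r"
      using gen[OF K K0] mult_left_mono[OF _ K0] by (meson order_trans)
    also have "\<dots> = 2 ^ r * (K * norm t ^ r)" by (simp add: power_mult_distrib)
    also have "\<dots> \<le> 2 ^ r * (\<epsilon> * (norm t ^ r + norm v ^ r) + K * norm t ^ r)"
      using eps by (intro mult_left_mono) auto
    finally show ?thesis using 2 by simp
  next
    case 3
    have "norm ?y * m \<le> \<delta> * m"
      using ym norm_triangle_ineq4[of t v] 3 by linarith
    then have "norm ?y \<le> \<delta>" using m(1) by simp
    then have "\<bar>E ?y\<bar> * m ^ r \<le> \<epsilon> * norm (t - v) ^ r" using gen[OF near eps] by blast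
    also have "\<dots> \<le> 2 ^ r * (\<epsilon> * (norm t ^ r + norm v ^ r))"
      using mult_left_mono[OF tv eps] by (simp add: mult_ac)
    finally show ?thesis using 3 by simp
  qed
qed

text \<open>The pointwise estimate is integrated against the absolute value of \<psi>. The constant
  \<open>A\<close> merges the integrals of orders 0 and \<open>r\<close>, so that \<open>v\<close>
  enters only through \<open>1 + norm v ^ r\<close> and the indicator.\<close>

lemma remainder_integral:
  fixes E \<psi> :: "real ^ 'n \<Rightarrow> real"
  assumes m: "m > 0" "\<And>i. m \<le> q $ i" and eps: "\<epsilon> \<ge> 0" and K0: "K \<ge> 0"
    and K: "\<And>y. \<bar>E y\<bar> \<le> K * norm y ^ r"
    and near: "\<And>y. norm y \<le> \<delta> \<Longrightarrow> \<bar>E y\<bar> \<le> \<epsilon> * norm y ^ r"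
    and meas: "E \<in> borel_measurable lebesgue"
    and \<psi>: "integrable lebesgue \<psi>" and \<psi>r: "integrable lebesgue (\<lambda>t. norm t ^ r * \<bar>\<psi> t\<bar>)"
  defines "A \<equiv> (LINT t|lebesgue. \<bar>\<psi> t\<bar>) + (LINT t|lebesgue. norm t ^ r * \<bar>\<psi> t\<bar>)"
  shows "integrable lebesgue (\<lambda>t. \<psi> t * E (vinv q * (t - v)))"
    and "\<bar>LINT t|lebesgue. \<psi> t * E (vinv q * (t - v))\<bar> * m ^ r \<le> 2 ^ r * (
      (\<epsilon> + K * indicator {v. norm v > \<delta> * m / 2} v) * (A * (1 + norm v ^ r))
      + K * norm_tail r \<psi> (\<delta> * m / 2))"
proof -
  have q: "q $ i > 0" for i using m(1) m(2)[of i] by linarith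
  let ?J = "\<lambda>t. \<psi> t * E (vinv q * (t - v))"
  define W where "W = \<delta> * m / 2"
  \<comment> \<open>This coefficient does not depend on the integration variable.\<close>
  define c where "c = \<epsilon> + K * indicator {v. norm v > W} v"
  have c0: "c \<ge> 0" using eps K0 by (simp add: c_def)
  define B where "B = (\<lambda>t. 2 ^ r * (c * (norm t ^ r * \<bar>\<psi> t\<bar> + norm v ^ r * \<bar>\<psi> t\<bar>)
      + K * (indicator {t. norm t > W} t * (norm t ^ r * \<bar>\<psi> t\<bar>))))"
  have [measurable]: "\<psi> \<in> borel_measurable lebesgue" "E \<in> borel_measurable lebesgue"
    "(\<lambda>t. norm t ^ r * \<bar>\<psi> t\<bar>) \<in> borel_measurable lebesgue"
    using \<psi> \<psi>r meas by auto
  have [measurable]: "(\<lambda>t. vinv q * (t - v)) \<in> lebesgue \<rightarrow>\<^sub>M lebesgue"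
    using measurable_vinv_affine[OF q, where x = 0] by simp
  have J: "?J \<in> borel_measurable lebesgue" by measurable
  have \<psi>t: "integrable lebesgue (\<lambda>t. indicator {t. norm t > w} t * (norm t ^ r * \<bar>\<psi> t\<bar>))" for w :: real
    using integrable_real_mult_indicator[OF sets_lebesgue_norm_gt \<psi>r] by (simp add: mult.commute)
  have B: "integrable lebesgue B"
    unfolding B_def using \<psi> \<psi>r \<psi>t
    by (intro integrable_mult_right Bochner_Integration.integrable_add integrable_abs) auto
  have bound: "norm (?J t) \<le> B t / m ^ r" for t
  proof -
    have "\<bar>E (vinv q * (t - v))\<bar> * m ^ r * \<bar>\<psi> t\<bar> \<le> 2 ^ r * (
      c * (norm t ^ r + norm v ^ r) + K * (indicator {t. norm t > W} t * norm t ^ r)) * \<bar>\<psi> t\<bar>"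
      unfolding c_def W_def by (intro mult_right_mono remainder_pointwise assms) auto
    also have "\<dots> = B t" by (simp add: B_def algebra_simps)
    finally show ?thesis using m by (simp add: abs_mult mult_ac pos_le_divide_eq)
  qed
  show int: "integrable lebesgue ?J"
  proof (rule Bochner_Integration.integrable_bound[of _ "\<lambda>t. B t / m ^ r"])
    show "AE t in lebesgue. norm (?J t) \<le> norm (B t / m ^ r)"
      using bound by (intro AE_I2) (metis abs_ge_self order_trans real_norm_def)
  qed (use B J in auto)
  have "norm (LINT t|lebesgue. ?J t) \<le> (LINT t|lebesgue. B t / m ^ r)"
    by (rule Bochner_Integration.integral_norm_bound_integral) (use B int bound in auto)
  then have "\<bar>LINT t|lebesgue. ?J t\<bar> * m ^ r \<le> (LINT t|lebesgue. B t)"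
    using m by (simp add: pos_le_divide_eq)
  also have "\<dots> = 2 ^ r * (c * ((LINT t|lebesgue. norm t ^ r * \<bar>\<psi> t\<bar>) + norm v ^ r * (LINT t|lebesgue. \<bar>\<psi> t\<bar>))
      + K * norm_tail r \<psi> (W))"
    unfolding B_def norm_tail_def using \<psi> \<psi>r \<psi>t
    by (subst integral_mult_right_zero, subst Bochner_Integration.integral_add)
      (auto simp: Bochner_Integration.integral_add)
  also have "\<dots> \<le> 2 ^ r * (c * (A * (1 + norm v ^ r)) + K * norm_tail r \<psi> (W))"
  proof -
    have "(LINT t|lebesgue. norm t ^ r * \<bar>\<psi> t\<bar>) + norm v ^ r * (LINT t|lebesgue. \<bar>\<psi> t\<bar>) \<le> A * (1 + norm v ^ r)"
      unfolding A_def by (simp add: algebra_simps)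
    then show ?thesis using c0 by (intro mult_left_mono add_right_mono) auto
  qed
  finally show "\<bar>LINT t|lebesgue. ?J t\<bar> * m ^ r \<le> 2 ^ r * (
      (\<epsilon> + K * indicator {v. norm v > \<delta> * m / 2} v) * (A * (1 + norm v ^ r))
      + K * norm_tail r \<psi> (\<delta> * m / 2))" by (simp add: c_def W_def)
qed

text \<open>The bound for \<open>J\<close> is multiplied by the absolute value of \<phi> and summed.
  The parts with \<epsilon> and \<tau> are controlled by \<open>D\<close>; the part with the
  indicator sees only the tail, where \<open>W \<ge> 1\<close> replaces
  \<open>1 + norm v ^ r\<close> by \<open>2 * norm v ^ r\<close>.\<close>

lemma remainder_sum:
  fixes \<phi> J :: "real ^ 'n \<Rightarrow> real"
  assumes m: "m > 0"
    and sum0: "(\<lambda>k. \<bar>\<phi> (u - lattice_pt k)\<bar>) summable_on UNIV"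
    and sumr: "(\<lambda>k. \<bar>\<phi> (u - lattice_pt k)\<bar> * norm (u - lattice_pt k) ^ r) summable_on UNIV"
    and D: "(\<Sum>\<^sub>\<infinity>k. \<bar>\<phi> (u - lattice_pt k)\<bar> * (1 + norm (u - lattice_pt k) ^ r)) \<le> D"
    and W: "W \<ge> 1"
    and \<eta>: "(\<Sum>\<^sub>\<infinity>k\<in>{k. norm (u - lattice_pt k) > W}.
        \<bar>\<phi> (u - lattice_pt k)\<bar> * norm (u - lattice_pt k) ^ r) \<le> \<eta>"
    and nonneg: "\<epsilon> \<ge> 0" "K \<ge> 0" "A \<ge> 0" "\<tau> \<ge> 0"
    and J: "\<And>v. \<bar>J v\<bar> * m ^ r \<le> 2 ^ r * (
      (\<epsilon> + K * indicator {v. norm v > W} v) * (A * (1 + norm v ^ r)) + K * \<tau>)"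
  shows "(\<lambda>k. \<phi> (u - lattice_pt k) * J (u - lattice_pt k)) summable_on UNIV"
    and "\<bar>\<Sum>\<^sub>\<infinity>k. \<phi> (u - lattice_pt k) * J (u - lattice_pt k)\<bar> * m ^ r
      \<le> 2 ^ r * (\<epsilon> * A * D + 2 * K * A * \<eta> + K * \<tau> * D)"
proof -
  let ?v = "\<lambda>k. u - lattice_pt k"
  let ?g = "\<lambda>k. \<bar>\<phi> (?v k)\<bar> * (1 + norm (?v k) ^ r)"
  let ?T = "{k. norm (?v k) > W}"
  \<comment> \<open>The tail is extended by zero so that it can be added to \<open>?g\<close> over
    the same index set.\<close>
  let ?h = "\<lambda>k. if k \<in> ?T then \<bar>\<phi> (?v k)\<bar> * norm (?v k) ^ r else 0"
  have g: "?g summable_on UNIV"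
    using summable_on_add[OF sum0 sumr] by (simp add: algebra_simps)
  have "(\<lambda>k. \<bar>\<phi> (?v k)\<bar> * norm (?v k) ^ r) summable_on ?T"
    using sumr by (rule summable_on_subset_banach) simp
  then have h: "?h summable_on UNIV"
    by (subst summable_on_cong_neutral[where T = ?T and g = "\<lambda>k. \<bar>\<phi> (?v k)\<bar> * norm (?v k) ^ r"]) auto
  have h_le: "(\<Sum>\<^sub>\<infinity>k. ?h k) \<le> \<eta>"
    using \<eta> by (subst infsum_cong_neutral[where T = ?T and g = "\<lambda>k. \<bar>\<phi> (?v k)\<bar> * norm (?v k) ^ r"]) auto
  define B where "B k = 2 ^ r * ((\<epsilon> * A + K * \<tau>) * ?g k + 2 * K * A * ?h k)" for k
  have B: "B summable_on UNIV"
    unfolding B_def by (intro summable_on_cmult_right summable_on_add g h)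
  have B_le: "(\<Sum>\<^sub>\<infinity>k. B k) \<le> 2 ^ r * ((\<epsilon> * A + K * \<tau>) * D + 2 * K * A * \<eta>)"
  proof -
    have "(\<Sum>\<^sub>\<infinity>k. B k) = 2 ^ r * ((\<epsilon> * A + K * \<tau>) * (\<Sum>\<^sub>\<infinity>k. ?g k) + 2 * K * A * (\<Sum>\<^sub>\<infinity>k. ?h k))"
      unfolding B_def using g h
      by (subst infsum_cmult_right, intro summable_on_cmult_right summable_on_add)
        (auto simp: infsum_add infsum_cmult_right summable_on_cmult_right)
    also have "\<dots> \<le> 2 ^ r * ((\<epsilon> * A + K * \<tau>) * D + 2 * K * A * \<eta>)"
      using D h_le nonneg by (intro mult_left_mono add_mono) auto
    finally show ?thesis .
  qed
  have bound: "norm (\<phi> (?v k) * J (?v k)) \<le> B k / m ^ r" for k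
  proof -
    have "norm (\<phi> (?v k) * J (?v k)) * m ^ r = \<bar>\<phi> (?v k)\<bar> * (\<bar>J (?v k)\<bar> * m ^ r)"
      by (simp add: abs_mult)
    also have "\<dots> \<le> \<bar>\<phi> (?v k)\<bar> * (2 ^ r * (
      (\<epsilon> + K * indicator {v. norm v > W} (?v k)) * (A * (1 + norm (?v k) ^ r)) + K * \<tau>))"
      by (intro mult_left_mono J) auto
    also have "\<dots> = 2 ^ r * (\<epsilon> * A * ?g k + K * \<tau> * \<bar>\<phi> (?v k)\<bar>
        + K * A * (indicator ?T k * ?g k))"
      by (simp add: algebra_simps indicator_def)
    also have "\<dots> \<le> 2 ^ r * (\<epsilon> * A * ?g k + K * \<tau> * ?g k + K * A * (2 * ?h k))"
    proof (intro mult_left_mono add_mono)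
      show "\<bar>\<phi> (?v k)\<bar> \<le> ?g k" by (simp add: algebra_simps)
      show "indicator ?T k * ?g k \<le> 2 * ?h k"
      proof (cases "k \<in> ?T")
        case True
        then have "1 \<le> norm (?v k) ^ r" using W by (intro one_le_power) auto
        then have "\<bar>\<phi> (?v k)\<bar> * (1 + norm (?v k) ^ r) \<le> \<bar>\<phi> (?v k)\<bar> * (2 * norm (?v k) ^ r)"
          by (intro mult_left_mono) auto
        then show ?thesis using True by (simp add: mult_ac)
      qed auto
    qed (use nonneg in auto)
    also have "\<dots> = B k" by (simp only: B_def algebra_simps)
    finally show ?thesis using m by (simp add: pos_le_divide_eq)
  qed
  have Bm: "(\<lambda>k. B k / m ^ r) summable_on UNIV"
    using summable_on_cmult_left[OF B, of "1 / m ^ r"] by simp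
  have abs: "(\<lambda>k. norm (\<phi> (?v k) * J (?v k))) summable_on UNIV"
    by (rule summable_on_comparison_test[OF Bm]) (use bound in auto)
  then show "(\<lambda>k. \<phi> (?v k) * J (?v k)) summable_on UNIV"
    by (rule abs_summable_summable)
  have "norm (\<Sum>\<^sub>\<infinity>k. \<phi> (?v k) * J (?v k)) \<le> (\<Sum>\<^sub>\<infinity>k. norm (\<phi> (?v k) * J (?v k)))"
    by (rule norm_infsum_bound) (rule abs)
  also have "\<dots> \<le> (\<Sum>\<^sub>\<infinity>k. B k / m ^ r)"
    by (rule infsum_mono[OF abs Bm]) (rule bound)
  also have "\<dots> = (\<Sum>\<^sub>\<infinity>k. B k) / m ^ r"
    using infsum_cmult_left[OF B, of "1 / m ^ r"] by simp
  finally have "\<bar>\<Sum>\<^sub>\<infinity>k. \<phi> (?v k) * J (?v k)\<bar> * m ^ r \<le> (\<Sum>\<^sub>\<infinity>k. B k)"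
    using m by (simp add: pos_le_divide_eq)
  also note B_le
  finally show "\<bar>\<Sum>\<^sub>\<infinity>k. \<phi> (?v k) * J (?v k)\<bar> * m ^ r
      \<le> 2 ^ r * (\<epsilon> * A * D + 2 * K * A * \<eta> + K * \<tau> * D)"
    by (simp add: algebra_simps)
qed

subsection \<open>Consequences of the moment hypotheses\<close>

text \<open>The maximum of the absolute moments dominates those of the pure powers
  \<open>axis i r\<close>, and these control the power of the norm.\<close>

lemma integrable_norm_power:
  fixes \<psi> :: "real ^ 'n \<Rightarrow> real"
  assumes \<psi>: "integrable lebesgue \<psi>" and fin: "max_abs_cont_moment r \<psi> < \<infinity>"
  shows "integrable lebesgue (\<lambda>t. norm t ^ r * \<bar>\<psi> t\<bar>)"
proof -
  have [measurable]: "\<psi> \<in> borel_measurable lebesgue" using \<psi> by simp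
  have comp: "integrable lebesgue (\<lambda>t. \<bar>t $ i\<bar> ^ r * \<bar>\<psi> t\<bar>)" for i
  proof (rule integrableI_bounded)
    have "abs_cont_moment \<psi> (axis i r) \<le> max_abs_cont_moment r \<psi>"
      unfolding max_abs_cont_moment_def
      by (intro Max_ge finite_imageI finite_mi_order_eq) auto
    then have "abs_cont_moment \<psi> (axis i r) < \<infinity>" using fin by (rule le_less_trans)
    then show "(\<integral>\<^sup>+ t. ennreal (norm (\<bar>t $ i\<bar> ^ r * \<bar>\<psi> t\<bar>)) \<partial>lebesgue) < \<infinity>"
      by (simp add: abs_cont_moment_def vpow_axis abs_vec_def abs_mult)
    have "(\<lambda>t :: real ^ 'n. \<bar>t $ i\<bar> ^ r) \<in> borel_measurable lebesgue"
      by (intro measurable_completion) measurable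
    then show "(\<lambda>t. \<bar>t $ i\<bar> ^ r * \<bar>\<psi> t\<bar>) \<in> borel_measurable lebesgue" by measurable
  qed
  have "(\<lambda>t :: real ^ 'n. norm t ^ r) \<in> borel_measurable lebesgue"
    by (intro measurable_completion) measurable
  then have meas: "(\<lambda>t. norm t ^ r * \<bar>\<psi> t\<bar>) \<in> borel_measurable lebesgue" by measurable
  have "integrable lebesgue (\<lambda>t. real CARD('n) ^ r * (\<Sum>i\<in>UNIV. \<bar>t $ i\<bar> ^ r * \<bar>\<psi> t\<bar>))"
    by (intro integrable_mult_right Bochner_Integration.integrable_sum comp)
  then show ?thesis
  proof (rule Bochner_Integration.integrable_bound)
    show "AE t in lebesgue. norm (norm t ^ r * \<bar>\<psi> t\<bar>)
        \<le> norm (real CARD('n) ^ r * (\<Sum>i\<in>UNIV. \<bar>t $ i\<bar> ^ r * \<bar>\<psi> t\<bar>))"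
    proof (rule AE_I2)
      fix t :: "real ^ 'n"
      have "norm t ^ r * \<bar>\<psi> t\<bar> \<le> real CARD('n) ^ r * (\<Sum>i\<in>UNIV. \<bar>t $ i\<bar> ^ r) * \<bar>\<psi> t\<bar>"
        by (intro mult_right_mono norm_power_le_sum_component) auto
      also have "\<dots> = real CARD('n) ^ r * (\<Sum>i\<in>UNIV. \<bar>t $ i\<bar> ^ r * \<bar>\<psi> t\<bar>)"
        by (simp only: sum_distrib_right mult.assoc)
      finally show "norm (norm t ^ r * \<bar>\<psi> t\<bar>)
        \<le> norm (real CARD('n) ^ r * (\<Sum>i\<in>UNIV. \<bar>t $ i\<bar> ^ r * \<bar>\<psi> t\<bar>))"
        by (simp add: abs_mult abs_of_nonneg[OF sum_nonneg])
    qed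
  qed (rule meas)
qed

lemma power_le_one_plus_power:
  fixes a :: real
  assumes "a \<ge> 0" "j \<le> r"
  shows "a ^ j \<le> 1 + a ^ r"
proof (cases "a \<le> 1")
  case True
  then have "a ^ j \<le> 1" using assms by (simp add: power_le_one)
  then show ?thesis using assms by (simp add: add_increasing2)
next
  case False
  then have "a ^ j \<le> a ^ r" using assms by (intro power_increasing) auto
  then show ?thesis by simp
qed

text \<open>Intermediate orders lie between 0 and \<open>r\<close>: a monomial of order at most
  \<open>r\<close> is bounded by \<open>1 + norm t ^ r\<close>.\<close>

lemma integrable_vpow_mult:
  fixes \<psi> :: "real ^ 'n \<Rightarrow> real"
  assumes \<psi>: "integrable lebesgue \<psi>" and \<psi>r: "integrable lebesgue (\<lambda>t. norm t ^ r * \<bar>\<psi> t\<bar>)"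
    and s: "mi_order s \<le> r"
  shows "integrable lebesgue (\<lambda>t. vpow t s * \<psi> t)"
proof -
  have "integrable lebesgue (\<lambda>t. \<bar>\<psi> t\<bar> + norm t ^ r * \<bar>\<psi> t\<bar>)"
    using \<psi> \<psi>r by (intro Bochner_Integration.integrable_add integrable_abs)
  then show ?thesis
  proof (rule Bochner_Integration.integrable_bound)
    have "(\<lambda>t :: real ^ 'n. vpow t s) \<in> borel_measurable lebesgue"
      by (intro measurable_completion) measurable
    moreover have "\<psi> \<in> borel_measurable lebesgue" using \<psi> by simp
    ultimately show "(\<lambda>t. vpow t s * \<psi> t) \<in> borel_measurable lebesgue" by measurable
    show "AE t in lebesgue. norm (vpow t s * \<psi> t) \<le> norm (\<bar>\<psi> t\<bar> + norm t ^ r * \<bar>\<psi> t\<bar>)"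
    proof (rule AE_I2)
      fix t :: "real ^ 'n"
      have "\<bar>vpow t s\<bar> \<le> 1 + norm t ^ r"
        using abs_vpow_le_norm_power[of t s] power_le_one_plus_power[OF norm_ge_zero s, of t] by linarith
      then have "\<bar>vpow t s\<bar> * \<bar>\<psi> t\<bar> \<le> (1 + norm t ^ r) * \<bar>\<psi> t\<bar>" by (rule mult_right_mono) simp
      then show "norm (vpow t s * \<psi> t) \<le> norm (\<bar>\<psi> t\<bar> + norm t ^ r * \<bar>\<psi> t\<bar>)"
        by (simp add: abs_mult distrib_right)
    qed
  qed
qed

text \<open>Order 0 comes from (i) and the higher orders from (ii). Independence of \<open>u\<close>
  identifies the description operator in \<open>discrete_moment\<close> with the common sum.\<close>

lemma discrete_moment_has_sum:
  fixes \<phi> :: "real ^ 'n \<Rightarrow> real"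
  assumes i_\<phi>: "\<And>u. ((\<lambda>k. \<phi> (u - lattice_pt k)) has_sum 1) UNIV"
    and ii: "\<And>h. 1 \<le> mi_order h \<Longrightarrow> mi_order h \<le> r \<Longrightarrow>
      \<exists>c. \<forall>u. discrete_moment_term \<phi> h u summable_on UNIV \<and> discrete_moment_at \<phi> h u = c"
    and s: "mi_order s \<le> r"
  shows "(discrete_moment_term \<phi> s u has_sum discrete_moment \<phi> s) UNIV"
proof -
  have "\<exists>c. \<forall>u. (discrete_moment_term \<phi> s u has_sum c) UNIV"
  proof (cases "s = 0")
    case True
    then have "discrete_moment_term \<phi> s u = (\<lambda>k. \<phi> (u - lattice_pt k))" for u
      by (simp add: discrete_moment_term_def[abs_def])
    then show ?thesis using i_\<phi> by auto
  next
    case False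
    then have "1 \<le> mi_order s" by (metis mi_order_eq_0_iff less_one not_le)
    from ii[OF this s] show ?thesis
      unfolding discrete_moment_at_def by (metis has_sum_infsum)
  qed
  then obtain c where c: "\<And>u. (discrete_moment_term \<phi> s u has_sum c) UNIV" by blast
  then have "discrete_moment_at \<phi> s u = c" for u
    unfolding discrete_moment_at_def by (rule infsumI)
  then have "discrete_moment \<phi> s = c"
    unfolding discrete_moment_def by (intro the_equality) auto
  with c show ?thesis by simp
qed

section \<open>Expansion of the operator, global remainder bound and size of the scaling\<close>

lemma mi_order_mono: "s \<le> h \<Longrightarrow> mi_order s \<le> mi_order h"
  unfolding mi_order_def by (intro sum_mono) (auto simp: less_eq_vec_def)

text \<open>Splitting \<open>g\<close> into a polynomial around \<open>x\<close> and
  \<open>E\<close>, the operator acts exactly on the polynomial by \<open>has_sum_vpow\<close>, and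
  the series with \<open>J\<close> is the contribution of \<open>E\<close>. This is an identity for
  one fixed \<open>q\<close>.\<close>

lemma durrmeyer_expansion:
  fixes \<phi> \<psi> g :: "real ^ 'n \<Rightarrow> real"
  assumes q: "\<And>i. q $ i > 0" and \<psi>: "integrable lebesgue \<psi>"
    and \<psi>r: "integrable lebesgue (\<lambda>t. norm t ^ r * \<bar>\<psi> t\<bar>)"
    and dm: "\<And>s u. mi_order s \<le> r \<Longrightarrow> (discrete_moment_term \<phi> s u has_sum M s) UNIV"
    and g: "g \<in> borel_measurable lebesgue"
    and E: "\<And>y. E y = g (x + y) - (\<Sum>h | mi_order h \<le> r. c h * vpow y h)"
    and J: "\<And>v. J v = (LINT t|lebesgue. \<psi> t * E (vinv q * (t - v)))"
    and int: "\<And>v. integrable lebesgue (\<lambda>t. \<psi> t * E (vinv q * (t - v)))"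
    and sum: "(\<lambda>k. \<phi> (q * x - lattice_pt k) * J (q * x - lattice_pt k)) summable_on UNIV"
  shows "durrmeyer \<phi> \<psi> q g x - (\<Sum>h | mi_order h \<le> r. c h / vpow q h *
      (\<Sum>s\<in>{s. s \<le> h}. real (mi_binom h s) * M (h - s) * cont_moment \<psi> s))
    = (\<Sum>\<^sub>\<infinity>k. \<phi> (q * x - lattice_pt k) * J (q * x - lattice_pt k))"
proof -
  let ?v = "\<lambda>k. q * x - lattice_pt k"
  let ?I = "\<lambda>h v. LINT t|lebesgue. \<psi> t * vpow (vinv q * (t - v)) h"
  let ?Q = "\<lambda>h. (\<Sum>s\<in>{s. s \<le> h}. real (mi_binom h s) * M (h - s) * cont_moment \<psi> s) / vpow q h"
  have \<psi>s: "integrable lebesgue (\<lambda>t. vpow t s * \<psi> t)" if "s \<le> h" "mi_order h \<le> r" for s h :: "nat ^ 'n"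
    using integrable_vpow_mult[OF \<psi> \<psi>r] mi_order_mono[OF that(1)] that(2) by simp
  have eq: "(LINT t|lebesgue. \<psi> t * g (x + vinv q * (t - v)))
      = J v + (\<Sum>h | mi_order h \<le> r. c h * ?I h v)" for v
  proof -
    have "\<psi> t * g (x + vinv q * (t - v)) = \<psi> t * E (vinv q * (t - v))
      + (\<Sum>h | mi_order h \<le> r. c h * (\<psi> t * vpow (vinv q * (t - v)) h))" for t
      by (simp add: E right_diff_distrib sum_distrib_left mult_ac)
    moreover have h_int: "integrable lebesgue (\<lambda>t. c h * (\<psi> t * vpow (vinv q * (t - v)) h))"
      if "h \<in> {h. mi_order h \<le> r}" for h
      using integral_vpow_shift(1)[OF \<psi>s] that by (intro integrable_mult_right) auto
    ultimately have "(LINT t|lebesgue. \<psi> t * g (x + vinv q * (t - v))) = J v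
      + (\<Sum>h | mi_order h \<le> r. LINT t|lebesgue. c h * (\<psi> t * vpow (vinv q * (t - v)) h))"
      unfolding J by (simp only: Bochner_Integration.integral_add[OF int Bochner_Integration.integrable_sum[OF h_int]]
          Bochner_Integration.integral_sum[OF h_int])
    then show ?thesis by simp
  qed
  have "((\<lambda>k. \<phi> (?v k) * J (?v k) + (\<Sum>h | mi_order h \<le> r. c h * (\<phi> (?v k) * ?I h (?v k))))
    has_sum ((\<Sum>\<^sub>\<infinity>k. \<phi> (?v k) * J (?v k)) + (\<Sum>h | mi_order h \<le> r. c h * ?Q h))) UNIV"
    using sum by (intro has_sum_add has_sum_infsum has_sum_sum has_sum_cmult_right has_sum_vpow
        finite_mi_order_le dm \<psi>s) (auto dest: mi_order_mono)
  then have "((\<lambda>k. \<phi> (?v k) * (LINT t|lebesgue. \<psi> t * g (x + vinv q * (t - ?v k))))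
    has_sum ((\<Sum>\<^sub>\<infinity>k. \<phi> (?v k) * J (?v k)) + (\<Sum>h | mi_order h \<le> r. c h * ?Q h))) UNIV"
    unfolding eq by (simp add: distrib_left sum_distrib_left mult_ac)
  then have "durrmeyer \<phi> \<psi> q g x = (\<Sum>\<^sub>\<infinity>k. \<phi> (?v k) * J (?v k)) + (\<Sum>h | mi_order h \<le> r. c h * ?Q h)"
    using \<psi> g q by (subst durrmeyer_eq) (auto intro: infsumI)
  then show ?thesis by simp
qed

text \<open>Near 0 the little-o condition gives the bound. Away from 0, the bounded \<open>g\<close>
  and the polynomial of degree at most \<open>r\<close> both grow no faster than
  \<open>norm y ^ r\<close>.\<close>

lemma taylor_remainder_bound:
  fixes g :: "real ^ 'n \<Rightarrow> real"
  assumes g: "\<And>u. \<bar>g u\<bar> \<le> C"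
    and o: "(\<lambda>y. g (x + y) - (\<Sum>h | mi_order h \<le> r. c h * vpow y h)) \<in> o[nhds 0](\<lambda>y. norm y ^ r)"
  obtains K where "K \<ge> 0"
    "\<And>y. \<bar>g (x + y) - (\<Sum>h | mi_order h \<le> r. c h * vpow y h)\<bar> \<le> K * norm y ^ r"
proof -
  let ?E = "\<lambda>y. g (x + y) - (\<Sum>h | mi_order h \<le> r. c h * vpow y h)"
  have C: "C \<ge> 0" using g[of 0] by linarith
  have "\<forall>\<^sub>F y in nhds 0. norm (?E y) \<le> 1 * norm (norm y ^ r)"
    by (rule landau_o.smallD[OF o]) simp
  then obtain d0 where d0: "d0 > 0" "\<And>y. norm y < d0 \<Longrightarrow> \<bar>?E y\<bar> \<le> norm y ^ r"
    unfolding eventually_nhds_metric by auto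
  define d where "d = min d0 1"
  have d: "d > 0" "d \<le> 1" using d0 by (auto simp: d_def)
  \<comment> \<open>The summand 1 serves the region \<open>norm y < d\<close>, the quotient the
    rest. Since \<open>d \<le> 1\<close>, for \<open>norm y \<ge> d\<close> every power
    \<open>norm y ^ j\<close> with \<open>j \<le> r\<close> is at most
    \<open>(norm y / d) ^ r\<close>.\<close>
  define K where "K = 1 + (C + (\<Sum>h :: nat ^ 'n | mi_order h \<le> r. \<bar>c h\<bar>)) / d ^ r"
  have S: "(\<Sum>h :: nat ^ 'n | mi_order h \<le> r. \<bar>c h\<bar>) \<ge> 0" by (rule sum_nonneg) simp
  have K1: "K \<ge> 1" unfolding K_def using S C d by simp
  have "\<bar>?E y\<bar> \<le> K * norm y ^ r" for y
  proof (cases "norm y < d")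
    case True
    then have "\<bar>?E y\<bar> \<le> 1 * norm y ^ r" using d0 by (simp add: d_def)
    also have "\<dots> \<le> K * norm y ^ r" by (rule mult_right_mono[OF K1]) simp
    finally show ?thesis .
  next
    case False
    define b where "b = (norm y / d) ^ r"
    have yd: "1 \<le> norm y / d" using False d by simp
    have pow: "norm y ^ j \<le> b" if "j \<le> r" for j
    proof -
      have "norm y ^ j \<le> (norm y / d) ^ j"
        using d by (intro power_mono) (auto simp: pos_le_divide_eq mult_left_le)
      also have "\<dots> \<le> b" unfolding b_def using yd that by (rule power_increasing[rotated])
      finally show ?thesis .
    qed
    have b1: "1 \<le> b" using pow[of 0] by simp
    have "\<bar>\<Sum>h | mi_order h \<le> r. c h * vpow y h\<bar> \<le> (\<Sum>h | mi_order h \<le> r. \<bar>c h * vpow y h\<bar>)"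
      by (rule sum_abs)
    also have "\<dots> \<le> (\<Sum>h :: nat ^ 'n | mi_order h \<le> r. \<bar>c h\<bar> * b)"
      using abs_vpow_le_norm_power pow
      by (intro sum_mono) (auto simp: abs_mult intro!: mult_left_mono intro: order_trans)
    also have "\<dots> = (\<Sum>h :: nat ^ 'n | mi_order h \<le> r. \<bar>c h\<bar>) * b" by (rule sum_distrib_right[symmetric])
    finally have "\<bar>?E y\<bar> \<le> C + (\<Sum>h :: nat ^ 'n | mi_order h \<le> r. \<bar>c h\<bar>) * b"
      using g[of "x + y"] by linarith
    also have "\<dots> \<le> (C + (\<Sum>h :: nat ^ 'n | mi_order h \<le> r. \<bar>c h\<bar>)) * b"
      using mult_left_mono[OF b1 C] by (simp add: distrib_right)
    also have "\<dots> = (K - 1) * norm y ^ r"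
      by (simp add: K_def b_def power_divide)
    also have "\<dots> \<le> K * norm y ^ r" by (intro mult_right_mono) auto
    finally show ?thesis .
  qed
  then show ?thesis using that[of K] K1 by auto
qed

text \<open>Eventually \<open>n / p n $ i\<close> lies between \<open>a $ i / 2\<close> and
  \<open>a $ i + 1\<close>, so all components have the order of \<open>n\<close>. Summing the bounds
  over \<open>i\<close> gives \<open>norm (p n) \<le> n * L\<close> and
  \<open>n \<le> U * p n $ i\<close>.\<close>

lemma scaling_comparable:
  fixes p :: "nat \<Rightarrow> real ^ 'n"
  assumes p_pos: "\<And>n i. n \<ge> 1 \<Longrightarrow> p n $ i > 0"
    and p_ratio: "\<And>i. (\<lambda>n. real n / p n $ i) \<longlonglongrightarrow> a $ i" and a_pos: "\<And>i. a $ i > 0"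
  obtains c where "c > 0" "\<forall>\<^sub>F n in sequentially. \<forall>i. c * norm (p n) \<le> p n $ i"
proof -
  define L where "L = (\<Sum>i\<in>UNIV. 2 / a $ i)"
  define U where "U = (\<Sum>i\<in>UNIV. a $ i + 1)"
  have L: "L > 0" unfolding L_def using a_pos by (intro sum_pos) auto
  have U: "U > 0" unfolding U_def using a_pos by (intro sum_pos) (auto intro: add_pos_pos)
  have 1: "\<forall>\<^sub>F n in sequentially. real n / p n $ i > a $ i / 2" for i
    using p_ratio a_pos[of i] by (intro order_tendstoD(1)) auto
  have 2: "\<forall>\<^sub>F n in sequentially. real n / p n $ i < a $ i + 1" for i
    using p_ratio by (intro order_tendstoD(2)) auto
  have "\<forall>\<^sub>F n in sequentially. (\<forall>i. real n / p n $ i > a $ i / 2) \<and> (\<forall>i. real n / p n $ i < a $ i + 1) \<and> n \<ge> 1"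
    using 1 2 by (intro eventually_conj eventually_all_finite eventually_ge_at_top)
  then have "\<forall>\<^sub>F n in sequentially. \<forall>i. 1 / (L * U) * norm (p n) \<le> p n $ i"
  proof eventually_elim
    case (elim n)
    show ?case
    proof
      fix i
      have pos: "p n $ j > 0" for j using p_pos elim by simp
      have "norm (p n) \<le> (\<Sum>j\<in>UNIV. \<bar>p n $ j\<bar>)" by (rule norm_le_l1_cart)
      also have "\<dots> \<le> (\<Sum>j\<in>UNIV. real n * (2 / a $ j))"
      proof (rule sum_mono)
        fix j
        have "a $ j / 2 < real n / p n $ j" using elim by blast
        then show "\<bar>p n $ j\<bar> \<le> real n * (2 / a $ j)"
          using pos[of j] a_pos[of j] by (simp add: field_simps)
      qed
      also have "\<dots> = real n * L" by (simp add: L_def sum_distrib_left)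
      finally have A: "norm (p n) \<le> real n * L" .
      have "a $ i + 1 \<le> U" unfolding U_def
        using a_pos[THEN less_imp_le] by (intro member_le_sum) auto
      moreover have "real n / p n $ i < a $ i + 1" using elim by blast
      ultimately have "real n / p n $ i \<le> U" by linarith
      then have "real n \<le> U * p n $ i" using pos[of i] by (simp add: field_simps)
      then have "real n * L \<le> U * p n $ i * L" using L by (intro mult_right_mono) auto
      with A have "norm (p n) \<le> L * U * p n $ i" by (simp add: mult_ac)
      then show "1 / (L * U) * norm (p n) \<le> p n $ i"
        using L U by (simp add: field_simps)
    qed
  qed
  then show ?thesis using that[of "1 / (L * U)"] L U by simp
qed

text \<open>Separates the term \<open>h = 0\<close>, which will cancel \<open>f x\<close>, from the
  orders that occur in the asymptotic formula.\<close>

lemma sum_mi_order_le: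
  fixes F :: "nat ^ 'n \<Rightarrow> real"
  shows "(\<Sum>h | mi_order h \<le> r. F h) = F 0 + (\<Sum>\<nu>=1..r. \<Sum>h | mi_order h = \<nu>. F h)"
proof -
  have "(\<Sum>h | mi_order h \<le> r. F h) = (\<Sum>\<nu>=0..r. \<Sum>h\<in>{h \<in> {h. mi_order h \<le> r}. mi_order h = \<nu>}. F h)"
    by (rule sum.group[symmetric]) (auto simp: finite_mi_order_le)
  also have "\<dots> = (\<Sum>\<nu>=0..r. \<Sum>h | mi_order h = \<nu>. F h)"
    by (intro sum.cong) auto
  also have "\<dots> = F 0 + (\<Sum>\<nu>=1..r. \<Sum>h | mi_order h = \<nu>. F h)"
    by (simp add: sum.atLeast_Suc_atMost mi_order_eq_0_iff)
  finally show ?thesis .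
qed

subsection \<open>The asymptotic expansion\<close>

theorem theorem1:
  fixes \<phi> \<psi> f :: "real ^ 'n \<Rightarrow> real"
    and p :: "nat \<Rightarrow> real ^ 'n"
    and a x :: "real ^ 'n"
    and r :: nat
  assumes r: "r \<ge> 1"
    and \<phi>: "\<phi> \<in> C0_space"
    and \<psi>: "integrable lebesgue \<psi>"
    and p_pos: "\<And>n i. n \<ge> 1 \<Longrightarrow> p n $ i > 0"
    and p_lim: "\<And>i. filterlim (\<lambda>n. p n $ i) at_top sequentially"
    and p_ratio: "\<And>i. (\<lambda>n. real n / p n $ i) \<longlonglongrightarrow> a $ i"
    and a_pos: "\<And>i. a $ i > 0"
    and i_\<phi>: "\<And>u. ((\<lambda>k. \<phi> (u - lattice_pt k)) has_sum 1) UNIV"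
    and i_\<psi>: "(LINT t|lebesgue. \<psi> t) = 1"
    and ii: "\<And>h. 1 \<le> mi_order h \<Longrightarrow> mi_order h \<le> r \<Longrightarrow>
      \<exists>c. \<forall>u. discrete_moment_term \<phi> h u summable_on UNIV \<and> discrete_moment_at \<phi> h u = c"
    and iii_fin: "max_abs_discrete_moment r \<phi> + max_abs_cont_moment r \<psi> < \<infinity>"
    and iii_lim: "uniform_limit UNIV
      (\<lambda>w u. \<Sum>\<^sub>\<infinity>k\<in>{k. norm (u - lattice_pt k) > w}.
        \<bar>\<phi> (u - lattice_pt k)\<bar> * norm (u - lattice_pt k) ^ r)
      (\<lambda>u. 0) at_top"
    and f: "f \<in> Linf_space"
    and f_loc: "C_locally_at r f x"
  shows "(\<lambda>n. durrmeyer \<phi> \<psi> (p n) f x - f x -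
      (\<Sum>\<nu>=1..r. \<Sum>h | mi_order h = \<nu>.
        mixed_partial h f x / (real (mi_fact h) * vpow (p n) h) *
        (\<Sum>s\<in>{s. s \<le> h}. real (mi_binom h s) * discrete_moment \<phi> (h - s) * cont_moment \<psi> s)))
    \<in> o(\<lambda>n. 1 / norm (p n) ^ r)"
proof -
  have fin: "max_abs_cont_moment r \<psi> < \<infinity>"
    using iii_fin by (simp add: ennreal_add_less_top)
  note \<psi>r = integrable_norm_power[OF \<psi> fin]
  have [measurable]: "\<psi> \<in> borel_measurable lebesgue" using \<psi> by simp
  have f_meas [measurable]: "f \<in> borel_measurable lebesgue" using f by (simp add: Linf_space_def)
  obtain C0 where C0: "AE u in lebesgue. \<bar>f u\<bar> \<le> C0" using f by (auto simp: Linf_space_def)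
  \<comment> \<open>\<open>C0\<close> makes the truncation \<open>g\<close> agree with
    \<open>f\<close> almost everywhere; \<open>\<bar>f x\<bar> + 1\<close> makes it agree with
    \<open>f\<close> near \<open>x\<close>, where \<open>f\<close> is continuous.\<close>
  define C where "C = max C0 (\<bar>f x\<bar> + 1)"
  define g where "g u = max (- C) (min C (f u))" for u
  have g_eq: "g u = f u" if "\<bar>f u\<bar> \<le> C" for u using that by (auto simp: g_def)
  have g_meas: "g \<in> borel_measurable lebesgue" unfolding g_def[abs_def] by measurable
  have "C \<ge> 0" by (simp add: C_def)
  then have g_bound: "\<bar>g u\<bar> \<le> C" for u by (auto simp: g_def)
  have fg_AE: "AE u in lebesgue. f u = g u"
    using C0 by eventually_elim (simp add: g_eq C_def)
  define c where "c h = mixed_partial h f x / mi_fact h" for h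
  define E where "E y = g (x + y) - (\<Sum>h | mi_order h \<le> r. c h * vpow y h)" for y
  have "isCont f x" using C_locally_at_isCont[OF f_loc, of "[]"] by simp
  then have "isCont (\<lambda>y. f (x + y)) 0"
    by (intro isCont_o2[where f = "\<lambda>y. x + y" and g = f]) auto
  then have "((\<lambda>y. f (x + y)) \<longlongrightarrow> f x) (nhds 0)"
    using tendsto_at_iff_tendsto_nhds[of "\<lambda>y. f (x + y)" 0] by (simp add: isCont_def)
  then have "\<forall>\<^sub>F y in nhds 0. dist (f (x + y)) (f x) < 1" by (rule tendstoD) simp
  \<comment> \<open>Near \<open>x\<close> the truncation is inactive, so \<open>E\<close> inherits
    the Taylor estimate of \<open>f\<close> although it is built from \<open>g\<close>.\<close>
  then have ev: "\<forall>\<^sub>F y in nhds 0. f (x + y) - (\<Sum>h | mi_order h \<le> r. c h * vpow y h) = E y"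
    by eventually_elim (auto simp: E_def dist_norm C_def intro!: g_eq[symmetric])
  have E_o: "E \<in> o[nhds 0](\<lambda>y. norm y ^ r)"
    using multivariate_taylor_peano[OF f_loc r] landau_o.small.in_cong[OF ev] unfolding c_def by simp
  obtain K where K0: "K \<ge> 0" and K: "\<And>y. \<bar>E y\<bar> \<le> K * norm y ^ r"
    using taylor_remainder_bound[OF g_bound E_o[unfolded E_def[abs_def]]] unfolding E_def by blast
  have E_meas: "E \<in> borel_measurable lebesgue"
  proof -
    \<comment> \<open>Translation by \<open>x\<close> is the case \<open>q = 1\<close>,
      \<open>v = 0\<close> of the affine map.\<close>
    have "(\<lambda>y. g (x + vinv 1 * (y - 0))) \<in> borel_measurable lebesgue"
      by (rule measurable_compose[OF measurable_vinv_affine g_meas]) simp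
    moreover have "vinv 1 = (1 :: real ^ 'n)" by (simp add: vinv_def vec_eq_iff)
    ultimately have [measurable]: "(\<lambda>y. g (x + y)) \<in> borel_measurable lebesgue" by simp
    have [measurable]: "(\<lambda>y. vpow y h) \<in> borel_measurable lebesgue" for h :: "nat ^ 'n"
      by (intro measurable_completion) measurable
    show ?thesis unfolding E_def[abs_def] by measurable
  qed
  have dm: "(discrete_moment_term \<phi> s u has_sum discrete_moment \<phi> s) UNIV" if "mi_order s \<le> r" for s u
    by (rule discrete_moment_has_sum[OF i_\<phi> ii that])
  have sum0: "(\<lambda>k. \<bar>\<phi> (u - lattice_pt k)\<bar>) summable_on UNIV" for u
    using summable_on_iff_abs_summable_on_real[THEN iffD1, OF has_sum_imp_summable[OF i_\<phi>[of u]]] by simp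
  have sumr: "(\<lambda>k. \<bar>\<phi> (u - lattice_pt k)\<bar> * norm (u - lattice_pt k) ^ r) summable_on UNIV" for u
    using has_sum_imp_summable[OF dm] by (intro norm_power_summable) simp
  have "bounded (range \<phi>)" using \<phi> by (simp add: C0_space_def)
  then obtain D where D0: "D \<ge> 0"
    and D: "\<And>u. (\<Sum>\<^sub>\<infinity>k. \<bar>\<phi> (u - lattice_pt k)\<bar> * (1 + norm (u - lattice_pt k) ^ r)) \<le> D"
    using discrete_kernel_uniform_bound[OF _ sum0 sumr iii_lim] by blast
  define A where "A = (LINT t|lebesgue. \<bar>\<psi> t\<bar>) + (LINT t|lebesgue. norm t ^ r * \<bar>\<psi> t\<bar>)"
  have A0: "A \<ge> 0" unfolding A_def by (intro add_nonneg_nonneg integral_nonneg_AE AE_I2) auto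
  have tail0: "norm_tail r \<psi> w \<ge> 0" for w
    unfolding norm_tail_def by (intro integral_nonneg_AE AE_I2) auto
  obtain l where l: "l > 0" "\<forall>\<^sub>F n in sequentially. \<forall>i. l * norm (p n) \<le> p n $ i"
    using scaling_comparable[OF p_pos p_ratio a_pos] by blast
  \<comment> \<open>Any single coordinate will do, being bounded by the norm;
    \<open>undefined\<close> stands for an arbitrary one.\<close>
  have p_norm: "filterlim (\<lambda>n. norm (p n)) at_top sequentially"
    by (rule filterlim_at_top_mono[OF p_lim[of undefined]])
      (auto intro!: always_eventually order_trans[OF abs_ge_self component_le_norm_cart])
  define J where "J n v = (LINT t|lebesgue. \<psi> t * E (vinv (p n) * (t - v)))" for n v
  define R where "R n = (\<Sum>\<^sub>\<infinity>k. \<phi> (p n * x - lattice_pt k) * J n (p n * x - lattice_pt k))" for n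
  have main: "\<forall>\<^sub>F n in sequentially.
      durrmeyer \<phi> \<psi> (p n) g x - (\<Sum>h | mi_order h \<le> r. c h / vpow (p n) h *
        (\<Sum>s\<in>{s. s \<le> h}. real (mi_binom h s) * discrete_moment \<phi> (h - s) * cont_moment \<psi> s)) = R n
      \<and> norm (R n) \<le> e * norm (1 / norm (p n) ^ r)" if e: "e > 0" for e
  proof -
    \<comment> \<open>One third of the allowance, after accounting for the factor
      \<open>2 ^ r\<close> and for the passage from \<open>m = l * norm (p n)\<close> to
      \<open>norm (p n)\<close>.\<close>
    define e' where "e' = e * l ^ r / (3 * 2 ^ r)"
    have e': "e' > 0" using e l by (simp add: e'_def)
    have small: "X * (e' / (X + 1)) \<le> e'" "e' / (X + 1) > 0" if "X \<ge> 0" for X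
      using that e' by (auto simp: divide_le_eq)
    define \<epsilon> where "\<epsilon> = e' / (A * D + 1)"
    define \<eta> where "\<eta> = e' / (2 * K * A + 1)"
    define \<tau> where "\<tau> = e' / (K * D + 1)"
    have pos: "\<epsilon> > 0" "\<eta> > 0" "\<tau> > 0"
      unfolding \<epsilon>_def \<eta>_def \<tau>_def using A0 D0 K0 by (auto intro!: small(2))
    have "\<forall>\<^sub>F y in nhds 0. norm (E y) \<le> \<epsilon> * norm (norm y ^ r)"
      by (rule landau_o.smallD[OF E_o pos(1)])
    then obtain d where d: "d > 0" "\<And>y. norm y < d \<Longrightarrow> \<bar>E y\<bar> \<le> \<epsilon> * norm y ^ r"
      unfolding eventually_nhds_metric by auto
    \<comment> \<open>Halving turns the strict inequality for \<open>d\<close> into the non-strict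
      one required by \<open>near\<close>.\<close>
    define \<delta> where "\<delta> = d / 2"
    have \<delta>: "\<delta> > 0" and near: "\<And>y. norm y \<le> \<delta> \<Longrightarrow> \<bar>E y\<bar> \<le> \<epsilon> * norm y ^ r"
      using d by (auto simp: \<delta>_def)
    \<comment> \<open>The splitting radius \<open>\<delta> * m / 2\<close> for
      \<open>m = l * norm (p n)\<close>. It tends to infinity, so both tails beyond it become
      small.\<close>
    define W where "W n = \<delta> * (l * norm (p n)) / 2" for n
    have W: "filterlim W at_top sequentially"
    proof -
      have "filterlim (\<lambda>n. (\<delta> * l / 2) * norm (p n)) at_top sequentially"
        using \<delta> l by (intro filterlim_tendsto_pos_mult_at_top[OF tendsto_const _ p_norm]) auto
      then show ?thesis by (simp add: W_def[abs_def] mult_ac)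
    qed
    have "\<forall>\<^sub>F w in at_top. \<forall>u\<in>UNIV. dist
      (\<Sum>\<^sub>\<infinity>k\<in>{k. norm (u - lattice_pt k) > w}. \<bar>\<phi> (u - lattice_pt k)\<bar> * norm (u - lattice_pt k) ^ r) 0 < \<eta>"
      by (rule uniform_limitD[OF iii_lim pos(2)])
    then have ev\<eta>: "\<forall>\<^sub>F n in sequentially. \<forall>u\<in>UNIV. dist
      (\<Sum>\<^sub>\<infinity>k\<in>{k. norm (u - lattice_pt k) > W n}. \<bar>\<phi> (u - lattice_pt k)\<bar> * norm (u - lattice_pt k) ^ r) 0 < \<eta>"
      using W by (rule eventually_compose_filterlim)
    have "\<forall>\<^sub>F w in at_top. norm_tail r \<psi> w < \<tau>"
      using norm_tail_tendsto_0[OF \<psi>r] pos(3) by (rule order_tendstoD)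
    then have ev\<tau>: "\<forall>\<^sub>F n in sequentially. norm_tail r \<psi> (W n) < \<tau>"
      using W by (rule eventually_compose_filterlim)
    have evW: "\<forall>\<^sub>F n in sequentially. W n \<ge> 1"
      using W by (simp add: filterlim_at_top)
    show ?thesis
      using ev\<eta> ev\<tau> evW l(2) eventually_ge_at_top[of 1]
    proof eventually_elim
      case (elim n)
      define m where "m = l * norm (p n)"
      have q: "\<And>i. p n $ i > 0" using p_pos elim by blast
      have "norm (p n) > 0" using q[of undefined] by (auto simp: vec_eq_iff intro: ccontr)
      then have m: "m > 0" using l by (simp add: m_def)
      have mq: "\<And>i. m \<le> p n $ i" using elim by (simp add: m_def)
      have Wm: "W n = \<delta> * m / 2" by (simp add: W_def m_def)
      have int: "integrable lebesgue (\<lambda>t. \<psi> t * E (vinv (p n) * (t - v)))" for v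
        by (rule remainder_integral(1)[OF m mq less_imp_le[OF pos(1)] K0 K near E_meas \<psi> \<psi>r])
      have J_bound: "\<bar>J n v\<bar> * m ^ r \<le> 2 ^ r * (
          (\<epsilon> + K * indicator {v. norm v > W n} v) * (A * (1 + norm v ^ r)) + K * norm_tail r \<psi> (W n))" for v
        unfolding J_def A_def Wm
        by (rule remainder_integral(2)[OF m mq less_imp_le[OF pos(1)] K0 K near E_meas \<psi> \<psi>r])
      let ?u = "p n * x"
      have \<eta>: "(\<Sum>\<^sub>\<infinity>k\<in>{k. norm (?u - lattice_pt k) > W n}.
          \<bar>\<phi> (?u - lattice_pt k)\<bar> * norm (?u - lattice_pt k) ^ r) \<le> \<eta>"
        using elim(1)[THEN bspec[OF _ UNIV_I], of ?u] by (simp add: dist_real_def)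
      note rs = remainder_sum[OF m sum0 sumr D elim(3) \<eta> less_imp_le[OF pos(1)] K0 A0 tail0 J_bound]
      have 1: "durrmeyer \<phi> \<psi> (p n) g x - (\<Sum>h | mi_order h \<le> r. c h / vpow (p n) h *
        (\<Sum>s\<in>{s. s \<le> h}. real (mi_binom h s) * discrete_moment \<phi> (h - s) * cont_moment \<psi> s)) = R n"
        unfolding R_def
        by (rule durrmeyer_expansion[OF q \<psi> \<psi>r dm g_meas E_def J_def int rs(1)])
      have "\<bar>R n\<bar> * m ^ r \<le> 2 ^ r * (\<epsilon> * A * D + 2 * K * A * \<eta> + K * norm_tail r \<psi> (W n) * D)"
        using rs(2) by (simp add: R_def)
      also have "\<dots> \<le> 2 ^ r * (e' + e' + e')"
      proof (intro mult_left_mono add_mono)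
        show "\<epsilon> * A * D \<le> e'" using small(1)[of "A * D"] A0 D0 by (simp add: \<epsilon>_def mult_ac)
        show "2 * K * A * \<eta> \<le> e'" using small(1)[of "2 * K * A"] A0 K0 by (simp add: \<eta>_def mult_ac)
        have "K * norm_tail r \<psi> (W n) * D \<le> K * \<tau> * D"
          using elim(2) K0 D0 by (intro mult_right_mono mult_left_mono) auto
        also have "\<dots> \<le> e'" using small(1)[of "K * D"] K0 D0 by (simp add: \<tau>_def mult_ac)
        finally show "K * norm_tail r \<psi> (W n) * D \<le> e'" .
      qed auto
      also have "\<dots> = e * l ^ r" by (simp add: e'_def)
      finally have "\<bar>R n\<bar> * norm (p n) ^ r * l ^ r \<le> e * l ^ r"
        by (simp add: m_def power_mult_distrib mult_ac)
      then have "\<bar>R n\<bar> * norm (p n) ^ r \<le> e" using l by simp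
      then have "norm (R n) \<le> e * norm (1 / norm (p n) ^ r)"
        using \<open>norm (p n) > 0\<close> by (simp add: pos_le_divide_eq)
      with 1 show ?case by blast
    qed
  qed
  \<comment> \<open>The zeroth order term is \<open>f x\<close>, because both moments of order zero
    equal 1 by (i).\<close>
  have const: "c 0 / vpow (p n) 0 *
      (\<Sum>s\<in>{s. s \<le> 0}. real (mi_binom 0 s) * discrete_moment \<phi> (0 - s) * cont_moment \<psi> s) = f x" for n
  proof -
    have "discrete_moment_term \<phi> 0 0 = (\<lambda>k. \<phi> (0 - lattice_pt k))"
      by (simp add: discrete_moment_term_def[abs_def])
    with i_\<phi>[of 0] have "(discrete_moment_term \<phi> 0 0 has_sum 1) UNIV" by simp
    moreover have "(discrete_moment_term \<phi> 0 0 has_sum discrete_moment \<phi> 0) UNIV"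
      by (rule dm) simp
    ultimately have "discrete_moment \<phi> 0 = 1" by (metis has_sum_unique)
    moreover have "cont_moment \<psi> 0 = 1" using i_\<psi> by (simp add: cont_moment_def)
    moreover have "{s :: nat ^ 'n. s \<le> 0} = {0}" by (auto simp: less_eq_vec_def vec_eq_iff)
    moreover have "mixed_partial 0 f = f"
      using sub_partial_0[of coords f] by (simp only: sub_partial_def mixed_partial_def)
    ultimately show ?thesis by (simp add: c_def mi_binom_def)
  qed
  show ?thesis
  proof (rule landau_o.smallI)
    fix e :: real assume "e > 0"
    from main[OF this] eventually_ge_at_top[of 1]
    show "\<forall>\<^sub>F n in sequentially. norm (durrmeyer \<phi> \<psi> (p n) f x - f x -
      (\<Sum>\<nu>=1..r. \<Sum>h | mi_order h = \<nu>.
        mixed_partial h f x / (real (mi_fact h) * vpow (p n) h) *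
        (\<Sum>s\<in>{s. s \<le> h}. real (mi_binom h s) * discrete_moment \<phi> (h - s) * cont_moment \<psi> s)))
      \<le> e * norm (1 / norm (p n) ^ r)"
    proof eventually_elim
      case (elim n)
      \<comment> \<open>The estimate was obtained for the truncation \<open>g\<close> and is now
        carried back to \<open>f\<close>.\<close>
      have "durrmeyer \<phi> \<psi> (p n) f x = durrmeyer \<phi> \<psi> (p n) g x"
        by (rule durrmeyer_cong_AE) (use p_pos elim f_meas g_meas fg_AE in auto)
      with elim show ?case
        unfolding sum_mi_order_le const by (simp add: c_def diff_diff_eq)
    qed
  qed
qed

end
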